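(* For any $c\in[1,1.01]$, any randomized protocol in the message passing model with $s$ sites that computes a $(7.1-6c,\,c)$-bicriteria approximation for $k$-median or $k$-means correctly with probability $0.99$ requires $\Omega(sk)$ bits of communication.
   Context: Given a finite set $P$ of (possibly weighted) points in a metric space and an integer $k$, $k$-median minimizes $\sum_{p\in P}d(p,C)$ and $k$-means minimizes $\sum_{p\in P}d(p,C)^2$ over center sets $C$, where $d(p,C)=\min_{x\in C}d(p,x)$ (weighted points contribute with their weight). An algorithm is a $(c_1,c_2)$-bicriteria approximation ($c_1,c_2\ge1$) if, whenever the optimal solution with $k$ centers has cost $W$, it outputs at most $c_2k$ centers with cost at most $c_1W$. Message passing (coordinator) model: the points are distributed among $s$ sites, each connected to a coordinator by a private two-way channel; the coordinator outputs the answer; communication cost is the total number of bits sent. *)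

theory Defs
  imports "HOL-Probability.Probability"
begin

section \<open>Clustering\<close>

text \<open>A weighted point set is a function \<open>w\<close> with finite support; an unweighted one takes values
  in \<open>{0, 1}\<close>.\<close>

definition points :: "('a \<Rightarrow> real) \<Rightarrow> 'a set" where
  "points w = {p. w p \<noteq> 0}"

definition center_dist :: "('a \<Rightarrow> 'a \<Rightarrow> real) \<Rightarrow> 'a \<Rightarrow> 'a set \<Rightarrow> real" where
  "center_dist d p C = Min (d p ` C)"

definition kmedian_cost :: "('a \<Rightarrow> 'a \<Rightarrow> real) \<Rightarrow> ('a \<Rightarrow> real) \<Rightarrow> 'a set \<Rightarrow> real" where
  "kmedian_cost d w C = (\<Sum>p\<in>points w. w p * center_dist d p C)"

definition kmeans_cost :: "('a \<Rightarrow> 'a \<Rightarrow> real) \<Rightarrow> ('a \<Rightarrow> real) \<Rightarrow> 'a set \<Rightarrow> real" where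
  "kmeans_cost d w C = (\<Sum>p\<in>points w. w p * (center_dist d p C)\<^sup>2)"

definition center_sets :: "'a set \<Rightarrow> real \<Rightarrow> 'a set set" where
  "center_sets S m = {C. C \<subseteq> S \<and> finite C \<and> C \<noteq> {} \<and> real (card C) \<le> m}"

text \<open>In the following, \<open>cost\<close> is one of the two cost functions, partially applied to the metric.\<close>

definition opt_cost :: "(('a \<Rightarrow> real) \<Rightarrow> 'a set \<Rightarrow> real) \<Rightarrow> 'a set \<Rightarrow> nat \<Rightarrow> ('a \<Rightarrow> real) \<Rightarrow> real" where
  "opt_cost cost S k w = (INF C\<in>center_sets S (real k). cost w C)"

definition bicriteria_solution ::
    "(('a \<Rightarrow> real) \<Rightarrow> 'a set \<Rightarrow> real) \<Rightarrow> 'a set \<Rightarrow> nat \<Rightarrow> real \<Rightarrow> real \<Rightarrow> ('a \<Rightarrow> real) \<Rightarrow> 'a set \<Rightarrow> bool" where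
  "bicriteria_solution cost S k c1 c2 w C \<longleftrightarrow>
     C \<in> center_sets S (c2 * real k) \<and> cost w C \<le> c1 * opt_cost cost S k w"


section \<open>Inputs distributed among the sites \<open>0, \<dots>, s - 1\<close>\<close>

definition distributed_input :: "bool \<Rightarrow> 'a set \<Rightarrow> nat \<Rightarrow> (nat \<Rightarrow> 'a \<Rightarrow> real) \<Rightarrow> bool" where
  "distributed_input weighted S s x \<longleftrightarrow>
     (\<forall>i<s. finite (points (x i)) \<and> points (x i) \<subseteq> S \<and> (\<forall>p. 0 \<le> x i p)) \<and>
     disjoint_family_on (\<lambda>i. points (x i)) {..<s} \<and>
     (\<not> weighted \<longrightarrow> (\<forall>i<s. \<forall>p. x i p \<in> {0, 1}))"

definition whole_input :: "nat \<Rightarrow> (nat \<Rightarrow> 'a \<Rightarrow> real) \<Rightarrow> 'a \<Rightarrow> real" where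
  "whole_input s x p = (\<Sum>i<s. x i p)"


section \<open>Message passing protocols\<close>

text \<open>One event is one bit crossing the private channel of the site given by its first argument.\<close>

datatype event = To_Site nat bool | To_Coord nat bool

primrec channel :: "event \<Rightarrow> nat" where
  "channel (To_Site i b) = i"
| "channel (To_Coord i b) = i"

definition view :: "nat \<Rightarrow> event list \<Rightarrow> event list" where
  "view i h = filter (\<lambda>e. channel e = i) h"

datatype 'a action = Send nat bool | Receive nat | Output "'a set"

text \<open>A deterministic protocol. The coordinator has no input and acts on the history of all channels;
  the bit that a site sends when the coordinator waits for it depends only on its own input and the
  history of its own channel.\<close>

record 'a protocol =
  coord :: "event list \<Rightarrow> 'a action"
  site :: "nat \<Rightarrow> ('a \<Rightarrow> real) \<Rightarrow> event list \<Rightarrow> bool"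

definition uses_sites :: "nat \<Rightarrow> 'a protocol \<Rightarrow> bool" where
  "uses_sites s \<pi> \<longleftrightarrow>
     (\<forall>h i b. coord \<pi> h = Send i b \<longrightarrow> i < s) \<and> (\<forall>h i. coord \<pi> h = Receive i \<longrightarrow> i < s)"

text \<open>\<open>run \<pi> x h\<close>: on input \<open>x\<close>, the bits sent so far may be \<open>h\<close> (in order). Since \<open>\<pi>\<close> is
  deterministic, these \<open>h\<close> form a chain; it is infinite if the protocol does not halt.\<close>

inductive run :: "'a protocol \<Rightarrow> (nat \<Rightarrow> 'a \<Rightarrow> real) \<Rightarrow> event list \<Rightarrow> bool" for \<pi> x where
  start: "run \<pi> x []"
| send: "run \<pi> x h \<Longrightarrow> coord \<pi> h = Send i b \<Longrightarrow> run \<pi> x (h @ [To_Site i b])"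
| receive: "run \<pi> x h \<Longrightarrow> coord \<pi> h = Receive i \<Longrightarrow>
    run \<pi> x (h @ [To_Coord i (site \<pi> i (x i) (view i h))])"

definition outputs :: "'a protocol \<Rightarrow> (nat \<Rightarrow> 'a \<Rightarrow> real) \<Rightarrow> 'a set \<Rightarrow> bool" where
  "outputs \<pi> x C \<longleftrightarrow> (\<exists>h. run \<pi> x h \<and> coord \<pi> h = Output C)"

text \<open>A randomized protocol is a probability distribution on deterministic protocols, i.e. the parties
  share public coins; private coins are the special case in which each party uses its own part of the
  random string.\<close>

definition randomized_protocol :: "nat \<Rightarrow> 'a protocol measure \<Rightarrow> bool" where
  "randomized_protocol s R \<longleftrightarrow> prob_space R \<and> (\<forall>\<pi>\<in>space R. uses_sites s \<pi>)"

text \<open>A non-measurable set has measure 0, so the bound below includes measurability of the success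
  event.\<close>

definition computes_bicriteria ::
    "real \<Rightarrow> bool \<Rightarrow> (('a \<Rightarrow> real) \<Rightarrow> 'a set \<Rightarrow> real) \<Rightarrow> 'a set \<Rightarrow> nat \<Rightarrow> nat \<Rightarrow> real \<Rightarrow> real \<Rightarrow>
     'a protocol measure \<Rightarrow> bool" where
  "computes_bicriteria q weighted cost S s k c1 c2 R \<longleftrightarrow>
     (\<forall>x. distributed_input weighted S s x \<longrightarrow>
        measure R {\<pi> \<in> space R. \<exists>C. outputs \<pi> x C \<and>
          bicriteria_solution cost S k c1 c2 (whole_input s x) C} \<ge> q)"

text \<open>Worst case over inputs and coins; infinite if the number of bits is unbounded.\<close>

definition communication :: "bool \<Rightarrow> 'a set \<Rightarrow> nat \<Rightarrow> 'a protocol measure \<Rightarrow> ereal" where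
  "communication weighted S s R =
     Sup {ereal (real (length h)) | h x \<pi>. distributed_input weighted S s x \<and> \<pi> \<in> space R \<and> run \<pi> x h}"

end

theory Submission
  imports Defs
begin

text \<open>
  The metric space has \<open>4 k\<close> locations at mutual distance 1, each with one copy per site at mutual
  distance \<open>1 / (8 k s)\<close>. If the sites hold sets of locations whose union has at most \<open>k\<close> elements, then
  the optimum is at most \<open>1 / 2\<close>, so the coordinator has to output at most \<open>1.01 k\<close> locations that cover
  the union: missing one of them costs at least 1.

  Let \<open>m = k - 1\<close>. Site 0 holds one of the two locations \<open>2 j, 2 j + 1\<close> for each \<open>j < m\<close>, namely
  \<open>2 j + 1\<close> iff \<open>j \<in> y\<close>. Every other site holds \<open>2 j\<close> for \<open>j\<close> in a random set \<open>x\<close> disjoint from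
  \<open>y\<close>, except that one random site may also hold \<open>2 j\<close> for a single \<open>j \<in> y\<close>. That site does not know \<open>y\<close>,
  so finding \<open>2 j\<close> is as hard as set disjointness and needs \<open>\<Omega>(k)\<close> bits on its channel. Fewer bits can
  predict only few elements of \<open>x\<close> or \<open>y\<close> better than by guessing, so that the coordinator sees nearly
  the same with and without the additional location. All sites are indistinguishable in this respect,
  which gives \<open>\<Omega>(s k)\<close> bits in total.
\<close>

section \<open>Prediction by short codes\<close>

text \<open>From \<open>(1 + t) * (1 - t + t^2) = 1 + t^3 \<ge> 1\<close> follows
  \<open>exp (- t) \<le> 1 - t + t^2\<close>; adding \<open>exp t \<le> 1 + t + t^2\<close> cancels
  the linear terms.\<close>

lemma exp_add_exp_minus_le:
  fixes s :: real
  assumes "\<bar>s\<bar> \<le> 1"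
  shows "exp s + exp (- s) \<le> 2 * exp (s\<^sup>2)"
proof -
  have *: "exp t + exp (- t) \<le> 2 * exp (t\<^sup>2)" if "0 \<le> t" "t \<le> 1" for t :: real
  proof -
    have "1 + t \<le> exp t"
      by (rule exp_ge_add_one_self)
    moreover have "1 \<le> (1 + t) * (1 - t + t\<^sup>2)"
      using that by (simp add: algebra_simps power2_eq_square)
    moreover have "0 \<le> 1 - t + t\<^sup>2"
      using that by simp
    ultimately have "1 \<le> exp t * (1 - t + t\<^sup>2)"
      by (meson mult_right_mono order_trans)
    then have "exp (- t) \<le> 1 - t + t\<^sup>2"
      by (simp add: exp_minus field_simps)
    moreover have "exp t \<le> 1 + t + t\<^sup>2"
      using that by (rule exp_bound)
    moreover have "1 + t\<^sup>2 \<le> exp (t\<^sup>2)"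
      by (rule exp_ge_add_one_self)
    ultimately show ?thesis
      by linarith
  qed
  show ?thesis
    using *[of s] *[of "- s"] assms by (cases "0 \<le> s") auto
qed

abbreviation sgn_in :: "'a \<Rightarrow> 'a set \<Rightarrow> real" where
  "sgn_in j x \<equiv> (if j \<in> x then 1 else - 1)"

lemma sum_Pow_insert:
  fixes f :: "'a set \<Rightarrow> 'b::comm_monoid_add"
  assumes "finite A" "a \<notin> A"
  shows "(\<Sum>x\<in>Pow (insert a A). f x) = (\<Sum>x\<in>Pow A. f x + f (insert a x))"
proof -
  have "inj_on (insert a) (Pow A)"
    using assms(2) by (auto simp: inj_on_def)
  moreover have "Pow A \<inter> insert a ` Pow A = {}"
    using assms(2) by auto
  ultimately show ?thesis
    using assms by (simp add: Pow_insert sum.union_disjoint sum.reindex sum.distrib)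
qed

lemma sum_Pow_complement:
  "(\<Sum>x\<in>Pow A. f (A - x)) = (\<Sum>x\<in>Pow A. f x)"
  by (rule sum.reindex_bij_witness[of _ "\<lambda>x. A - x" "\<lambda>x. A - x"]) (auto simp: double_diff)

text \<open>The moment generating function of a sum of independent signs: the exponential factors
  over the elements, and \<open>exp_add_exp_minus_le\<close> bounds each factor.\<close>

lemma sum_exp_signs_le:
  fixes c :: "'a \<Rightarrow> real"
  assumes "finite V" "\<And>j. j \<in> V \<Longrightarrow> \<bar>c j\<bar> \<le> t" "t \<le> 1"
  shows "(\<Sum>x\<in>Pow V. exp (\<Sum>j\<in>V. c j * sgn_in j x)) \<le> 2 ^ card V * exp (t\<^sup>2 * card V)"
  using assms
proof (induction V rule: finite_induct)
  case empty
  then show ?case by simp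
next
  case (insert a V)
  have eq: "(\<Sum>j\<in>V. c j * sgn_in j (insert a x)) = (\<Sum>j\<in>V. c j * sgn_in j x)" for x
    using insert.hyps by (intro sum.cong) auto
  have ca: "\<bar>c a\<bar> \<le> t" and "0 \<le> t"
    using insert.prems(1)[of a] by auto
  then have "(c a)\<^sup>2 \<le> t\<^sup>2"
    by (simp add: abs_le_square_iff[symmetric])
  then have step: "exp (c a) + exp (- c a) \<le> 2 * exp (t\<^sup>2)"
    using exp_add_exp_minus_le[of "c a"] ca \<open>t \<le> 1\<close> by (smt (verit) exp_le_cancel_iff)
  have "(\<Sum>x\<in>Pow (insert a V). exp (\<Sum>j\<in>insert a V. c j * sgn_in j x))
      = (\<Sum>x\<in>Pow V. exp (c a) * exp (\<Sum>j\<in>V. c j * sgn_in j x)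
          + exp (- c a) * exp (\<Sum>j\<in>V. c j * sgn_in j x))"
    using insert.hyps
    by (subst sum_Pow_insert) (auto simp: eq exp_add[symmetric] add.commute intro!: sum.cong)
  also have "\<dots> = (exp (c a) + exp (- c a)) * (\<Sum>x\<in>Pow V. exp (\<Sum>j\<in>V. c j * sgn_in j x))"
    by (simp add: sum.distrib sum_distrib_left distrib_right)
  also have "\<dots> \<le> (2 * exp (t\<^sup>2)) * (2 ^ card V * exp (t\<^sup>2 * card V))"
    using insert.IH insert.prems step by (intro mult_mono) (auto intro: sum_nonneg add_nonneg_nonneg)
  also have "\<dots> = 2 ^ card (insert a V) * exp (t\<^sup>2 * card (insert a V))"
    using insert.hyps by (simp add: exp_add[symmetric] algebra_simps)
  finally show ?case .
qed

text \<open>\<open>\<tau>\<close> is a code of the pairs \<open>(x, y)\<close> with code lengths \<open>lam\<close> obeying Kraft's inequality. A short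
  code word \<open>v\<close> cannot predict many of the bits of \<open>x\<close> by its guesses \<open>\<sigma> v\<close>. The reason is
  \<open>t S \<le> L - 1 + exp (t S - L)\<close>, summed with \<open>L = lam v + t\<^sup>2 |V|\<close>.\<close>

lemma code_prediction_bound:
  fixes \<sigma> :: "'v \<Rightarrow> 'a \<Rightarrow> real" and lam :: "'v \<Rightarrow> real"
  assumes "finite V" "finite Y" "0 \<le> t" "t \<le> 1" "\<And>v j. \<bar>\<sigma> v j\<bar> \<le> 1"
    and kraft: "(\<Sum>v\<in>(\<lambda>(x, y). \<tau> x y) ` (Pow V \<times> Y). exp (- lam v)) \<le> 1"
  shows "t * (\<Sum>y\<in>Y. \<Sum>x\<in>Pow V. \<Sum>j\<in>V. \<sigma> (\<tau> x y) j * sgn_in j x)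
    \<le> (\<Sum>y\<in>Y. \<Sum>x\<in>Pow V. lam (\<tau> x y) + t\<^sup>2 * card V)"
proof -
  define R where "R = (\<lambda>(x, y). \<tau> x y) ` (Pow V \<times> Y)"
  define S where "S v x = t * (\<Sum>j\<in>V. \<sigma> v j * sgn_in j x)" for v x
  define L where "L v = lam v + t\<^sup>2 * card V" for v
  have finR: "finite R"
    using assms by (simp add: R_def)
  have pointwise: "S v x \<le> L v - 1 + exp (S v x - L v)" for v x
    using exp_ge_add_one_self[of "S v x - L v"] by linarith
  have mgf: "(\<Sum>x\<in>Pow V. exp (S v x)) \<le> 2 ^ card V * exp (t\<^sup>2 * card V)" for v
    using sum_exp_signs_le[of V "\<lambda>j. t * \<sigma> v j" t] assms
    by (simp add: S_def sum_distrib_left mult.assoc abs_mult mult_left_le)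
  have "(\<Sum>x\<in>Pow V. exp (S (\<tau> x y) x - L (\<tau> x y))) \<le> 2 ^ card V" if "y \<in> Y" for y
  proof -
    \<comment> \<open>The code word depends on \<open>x\<close>, so it is replaced by the sum over
      all code words. Each of them faces a uniform \<open>x\<close>, and Kraft's inequality pays for
      their number.\<close>
    have "(\<Sum>x\<in>Pow V. exp (S (\<tau> x y) x - L (\<tau> x y))) \<le> (\<Sum>x\<in>Pow V. \<Sum>v\<in>R. exp (S v x - L v))"
    proof (rule sum_mono)
      fix x assume "x \<in> Pow V"
      then have "\<tau> x y \<in> R"
        using that by (auto simp: R_def)
      then show "exp (S (\<tau> x y) x - L (\<tau> x y)) \<le> (\<Sum>v\<in>R. exp (S v x - L v))"
        using finR by (intro member_le_sum) auto
    qed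
    also have "\<dots> = (\<Sum>v\<in>R. exp (- L v) * (\<Sum>x\<in>Pow V. exp (S v x)))"
      by (subst sum.swap) (simp add: sum_distrib_left exp_add[symmetric])
    also have "\<dots> \<le> (\<Sum>v\<in>R. exp (- L v) * (2 ^ card V * exp (t\<^sup>2 * card V)))"
      by (intro sum_mono mult_left_mono mgf) auto
    also have "\<dots> = 2 ^ card V * (\<Sum>v\<in>R. exp (- lam v))"
      by (simp add: L_def sum_distrib_left exp_add exp_diff exp_minus field_simps)
    also have "\<dots> \<le> 2 ^ card V * 1"
      using kraft by (intro mult_left_mono) (auto simp: R_def)
    finally show ?thesis by simp
  qed
  then have "(\<Sum>y\<in>Y. \<Sum>x\<in>Pow V. exp (S (\<tau> x y) x - L (\<tau> x y))) \<le> (\<Sum>y\<in>Y. \<Sum>x\<in>Pow V. 1)"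
    using assms by (intro sum_mono[of Y]) (simp add: card_Pow)
  moreover have "(\<Sum>y\<in>Y. \<Sum>x\<in>Pow V. S (\<tau> x y) x)
      \<le> (\<Sum>y\<in>Y. \<Sum>x\<in>Pow V. L (\<tau> x y) - 1 + exp (S (\<tau> x y) x - L (\<tau> x y)))"
    by (intro sum_mono pointwise)
  ultimately have "(\<Sum>y\<in>Y. \<Sum>x\<in>Pow V. S (\<tau> x y) x) \<le> (\<Sum>y\<in>Y. \<Sum>x\<in>Pow V. L (\<tau> x y))"
    by (simp add: sum.distrib sum_subtractf)
  then show ?thesis
    by (simp add: S_def L_def sum_distrib_left)
qed

text \<open>Double counting of the pairs \<open>(V, j)\<close> with \<open>j \<in> V\<close>; the
  left side is indexed by \<open>V - {j}\<close>.\<close>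

lemma sum_insert_swap:
  fixes f :: "'a set \<Rightarrow> 'a \<Rightarrow> 'b::comm_monoid_add"
  assumes "finite E"
  shows "(\<Sum>j\<in>E. \<Sum>V\<in>Pow (E - {j}). f (insert j V) j) = (\<Sum>V\<in>Pow E. \<Sum>j\<in>V. f V j)"
proof -
  have "(\<Sum>j\<in>E. \<Sum>V\<in>Pow (E - {j}). f (insert j V) j) = (\<Sum>(j, V)\<in>Sigma E (\<lambda>j. Pow (E - {j})). f (insert j V) j)"
    using assms by (subst sum.Sigma) auto
  also have "\<dots> = (\<Sum>(V, j)\<in>Sigma (Pow E) (\<lambda>V. V). f V j)"
    by (rule sum.reindex_bij_witness[of _ "\<lambda>(V, j). (j, V - {j})" "\<lambda>(j, V). (insert j V, j)"])
      (auto simp: insert_absorb)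
  also have "\<dots> = (\<Sum>V\<in>Pow E. \<Sum>j\<in>V. f V j)"
    using assms by (subst sum.Sigma) (auto intro: finite_subset)
  finally show ?thesis .
qed

section \<open>Random frames\<close>

text \<open>Up to normalization, the mean over a distribution on disjoint pairs that is standard for
  set disjointness: given the frame \<open>W\<close>, the sets \<open>x\<close> and \<open>y\<close>
  are independent and uniform. Each element has four equally likely states and lies in
  \<open>x\<close>, or in \<open>y\<close>, with probability 1/4 each.\<close>

definition frame_sum :: "'a set \<Rightarrow> ('a set \<Rightarrow> 'a set \<Rightarrow> real) \<Rightarrow> real" where
  "frame_sum E G = (\<Sum>W\<in>Pow E. \<Sum>x\<in>Pow (E - W). \<Sum>y\<in>Pow W. G x y)"

lemma frame_sum_add: "frame_sum E (\<lambda>x y. F x y + G x y) = frame_sum E F + frame_sum E G"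
  by (simp add: frame_sum_def sum.distrib)

lemma frame_sum_mult: "frame_sum E (\<lambda>x y. c * G x y) = c * frame_sum E G"
  by (simp add: frame_sum_def sum_distrib_left)

lemma frame_sum_mono:
  assumes "\<And>x y. x \<subseteq> E \<Longrightarrow> y \<subseteq> E \<Longrightarrow> x \<inter> y = {} \<Longrightarrow> F x y \<le> G x y"
  shows "frame_sum E F \<le> frame_sum E G"
  unfolding frame_sum_def by (intro sum_mono assms) auto

text \<open>The new element is in \<open>W\<close> or not, and chosen or not; the two states in
  which it is not chosen leave \<open>x\<close> and \<open>y\<close> unchanged.\<close>

lemma frame_sum_insert:
  assumes "finite E" "a \<notin> E"
  shows "frame_sum (insert a E) G
    = 2 * frame_sum E G + frame_sum E (\<lambda>x y. G (insert a x) y) + frame_sum E (\<lambda>x y. G x (insert a y))"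
proof -
  have step: "(\<Sum>x\<in>Pow (insert a E - W). \<Sum>y\<in>Pow W. G x y)
      + (\<Sum>x\<in>Pow (insert a E - insert a W). \<Sum>y\<in>Pow (insert a W). G x y)
      = 2 * (\<Sum>x\<in>Pow (E - W). \<Sum>y\<in>Pow W. G x y) + (\<Sum>x\<in>Pow (E - W). \<Sum>y\<in>Pow W. G (insert a x) y)
       + (\<Sum>x\<in>Pow (E - W). \<Sum>y\<in>Pow W. G x (insert a y))" if "W \<in> Pow E" for W
  proof -
    have "insert a E - W = insert a (E - W)" "insert a E - insert a W = E - W" "a \<notin> E - W" "a \<notin> W"
      "finite (E - W)" "finite W"
      using that assms by (auto intro: finite_subset)
    then show ?thesis
      by (simp add: sum_Pow_insert sum.distrib del: Pow_insert)
  qed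
  show ?thesis
    unfolding frame_sum_def sum_Pow_insert[OF assms]
    by (subst sum.cong[OF refl step]) (simp_all add: sum.distrib sum_distrib_left)
qed

lemma frame_sum_1: "finite E \<Longrightarrow> frame_sum E (\<lambda>x y. 1) = 4 ^ card E"
  by (induction E rule: finite_induct) (simp_all add: frame_sum_insert, simp add: frame_sum_def)

lemma frame_sum_card:
  assumes "finite E"
  shows "frame_sum E (\<lambda>x y. real (card y)) = card E / 4 * 4 ^ card E"
  using assms
proof (induction E rule: finite_induct)
  case empty
  then show ?case by (simp add: frame_sum_def)
next
  case (insert a E)
  have "frame_sum E (\<lambda>x y. real (card (insert a y))) = frame_sum E (\<lambda>x y. real (card y) + 1)"
    unfolding frame_sum_def
  proof (intro sum.cong refl)
    fix W x y assume "W \<in> Pow E" "y \<in> Pow W"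
    then have "finite y" "a \<notin> y"
      using insert.hyps by (auto intro: finite_subset)
    then show "real (card (insert a y)) = real (card y) + 1"
      by simp
  qed
  then show ?case
    using insert by (simp add: frame_sum_insert frame_sum_add frame_sum_1 field_simps)
qed

text \<open>For a random frame \<open>W\<close> and uniform \<open>x \<subseteq> E - W\<close>, \<open>y \<subseteq> W\<close>, the set \<open>x\<close> given \<open>y\<close> is distributed
  as \<open>u - y\<close>, where \<open>u\<close> is independent of \<open>y\<close> and contains each element with probability 1/3.\<close>

lemma frame_sum_resample:
  assumes "finite E"
  shows "frame_sum E G = 2 ^ card E * (\<Sum>y\<in>Pow E. (1/3) ^ card y * (\<Sum>u\<in>Pow E. (1/2) ^ card u * G (u - y) y))"
  using assms
proof (induction E arbitrary: G rule: finite_induct)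
  case empty
  then show ?case by (simp add: frame_sum_def)
next
  case (insert a E)
  define T where "T G = (\<Sum>y\<in>Pow E. \<Sum>u\<in>Pow E. (1/3) ^ card y * (1/2) ^ card u * G (u - y) y)"
    for G :: "'a set \<Rightarrow> 'a set \<Rightarrow> real"
  have IH: "frame_sum E H = 2 ^ card E * T H" for H
    using insert.IH by (simp add: T_def sum_distrib_left mult.assoc)
  \<comment> \<open>Weights of \<open>a\<close>: 1 in neither set, 1/2 in \<open>u\<close> only, and
    \<open>1/3 * (1 + 1/2) = 1/2\<close> in \<open>y\<close>, since \<open>u - y\<close> does not
    see whether \<open>u\<close> contains it too. Twice these are the coefficients 2, 1, 1 of
    \<open>frame_sum_insert\<close>.\<close>
  have "(\<Sum>y\<in>Pow (insert a E). (1/3) ^ card y * (\<Sum>u\<in>Pow (insert a E). (1/2) ^ card u * G (u - y) y))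
      = (\<Sum>y\<in>Pow E. \<Sum>u\<in>Pow E. (1/3) ^ card y * (1/2) ^ card u * G (u - y) y
         + 1/2 * ((1/3) ^ card y * (1/2) ^ card u * G (insert a (u - y)) y)
         + 1/2 * ((1/3) ^ card y * (1/2) ^ card u * G (u - y) (insert a y)))"
    unfolding sum_Pow_insert[OF insert.hyps(1,2)] sum_distrib_left sum.distrib[symmetric]
  proof (intro sum.cong refl)
    fix y u assume yu: "y \<in> Pow E" "u \<in> Pow E"
    then have *: "a \<notin> y" "a \<notin> u" "finite y" "finite u"
      using insert.hyps by (auto intro: finite_subset)
    then have "insert a u - y = insert a (u - y)" "u - insert a y = u - y" "insert a u - insert a y = u - y"
      by auto
    then show "(1/3) ^ card y * ((1/2) ^ card u * G (u - y) y + (1/2) ^ card (insert a u) * G (insert a u - y) y)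
      + (1/3) ^ card (insert a y) * ((1/2) ^ card u * G (u - insert a y) (insert a y)
        + (1/2) ^ card (insert a u) * G (insert a u - insert a y) (insert a y))
      = (1/3) ^ card y * (1/2) ^ card u * G (u - y) y
         + 1/2 * ((1/3) ^ card y * (1/2) ^ card u * G (insert a (u - y)) y)
         + 1/2 * ((1/3) ^ card y * (1/2) ^ card u * G (u - y) (insert a y))"
      using * by (simp add: algebra_simps)
  qed
  also have "\<dots> = T G + 1/2 * T (\<lambda>x y. G (insert a x) y) + 1/2 * T (\<lambda>x y. G x (insert a y))"
    unfolding T_def by (simp add: sum.distrib sum_distrib_left)
  finally show ?case
    using insert.hyps by (simp add: frame_sum_insert IH algebra_simps)
qed

section \<open>Product weights and resampling of one coordinate\<close>

lemma sum_PiE_insert: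
  assumes "i \<notin> I"
  shows "(\<Sum>u\<in>PiE (insert i I) B. f u) = (\<Sum>v\<in>B i. \<Sum>u\<in>PiE I B. f (u(i := v)))"
  unfolding PiE_insert_eq sum.reindex[OF inj_combinator[OF assms]]
  by (simp add: sum.cartesian_product case_prod_unfold)

text \<open>Averaging over a fresh value of coordinate \<open>i\<close> preserves a mean under
  product weights; the factor is the total weight of the old value, which \<open>F\<close> no longer
  sees.\<close>

lemma sum_PiE_resample:
  fixes w :: "'b \<Rightarrow> real"
  assumes "finite I" "i \<in> I"
  shows "(\<Sum>u\<in>PiE I (\<lambda>_. B). (\<Prod>l\<in>I. w (u l)) * (\<Sum>v\<in>B. w v * F (u(i := v))))
    = (\<Sum>v\<in>B. w v) * (\<Sum>u\<in>PiE I (\<lambda>_. B). (\<Prod>l\<in>I. w (u l)) * F u)"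
proof -
  define J where "J = I - {i}"
  have I: "I = insert i J" "i \<notin> J" "finite J"
    using assms by (auto simp: J_def)
  have *: "(\<Prod>l\<in>I. w ((u(i := v)) l)) = w v * (\<Prod>l\<in>J. w (u l))" for u v
  proof -
    have "(\<Prod>l\<in>J. w ((u(i := v)) l)) = (\<Prod>l\<in>J. w (u l))"
      using I by (intro prod.cong) auto
    then show ?thesis using I by simp
  qed
  have "(\<Sum>u\<in>PiE I (\<lambda>_. B). (\<Prod>l\<in>I. w (u l)) * (\<Sum>v\<in>B. w v * F (u(i := v))))
     = (\<Sum>v'\<in>B. \<Sum>u\<in>PiE J (\<lambda>_. B). w v' * (\<Prod>l\<in>J. w (u l)) * (\<Sum>v\<in>B. w v * F (u(i := v))))"
    using * by (simp add: I(1) sum_PiE_insert[OF I(2)] del: fun_upd_apply)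
  also have "\<dots> = (\<Sum>v\<in>B. w v) * (\<Sum>u\<in>PiE J (\<lambda>_. B). (\<Prod>l\<in>J. w (u l)) * (\<Sum>v\<in>B. w v * F (u(i := v))))"
    by (simp add: sum_product mult.assoc)
  also have "(\<Sum>u\<in>PiE J (\<lambda>_. B). (\<Prod>l\<in>J. w (u l)) * (\<Sum>v\<in>B. w v * F (u(i := v))))
     = (\<Sum>v\<in>B. \<Sum>u\<in>PiE J (\<lambda>_. B). w v * (\<Prod>l\<in>J. w (u l)) * F (u(i := v)))"
    by (subst sum.swap) (simp add: sum_distrib_left mult_ac)
  also have "\<dots> = (\<Sum>u\<in>PiE I (\<lambda>_. B). (\<Prod>l\<in>I. w (u l)) * F u)"
    using * by (simp add: I(1) sum_PiE_insert[OF I(2)] del: fun_upd_apply)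
  finally show ?thesis .
qed

section \<open>Kraft's inequality for the views of one channel\<close>

lemma card_channel: "finite {e. channel e = i}" "card {e. channel e = i} = 4"
proof -
  have "{e. channel e = i} = {To_Site i True, To_Site i False, To_Coord i True, To_Coord i False}"
  proof (intro set_eqI)
    fix e show "e \<in> {e. channel e = i} \<longleftrightarrow> e \<in> {To_Site i True, To_Site i False, To_Coord i True, To_Coord i False}"
      by (cases e) auto
  qed
  then show "finite {e. channel e = i}" "card {e. channel e = i} = 4"
    by simp_all
qed

text \<open>A channel has \<open>4 ^ n\<close> words of length \<open>n\<close>. The weight
  \<open>exp (- code_length v) = 1/2 * (1/8) ^ length v\<close> gives them total weight
  \<open>1/2 * (1/2) ^ n\<close>, so Kraft's inequality holds for any set of words, prefix-free or
  not.\<close>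

definition code_length :: "event list \<Rightarrow> real" where
  "code_length v = ln 2 + length v * ln 8"

lemma kraft_code_length:
  assumes "finite R" "\<And>v e. v \<in> R \<Longrightarrow> e \<in> set v \<Longrightarrow> channel e = i"
  shows "(\<Sum>v\<in>R. exp (- code_length v)) \<le> 1"
proof -
  define N where "N = Max (insert 0 (length ` R))"
  define A where "A n = {v. set v \<subseteq> {e. channel e = i} \<and> length v = n}" for n
  have finA: "finite (A n)" for n
    unfolding A_def by (rule finite_lists_length_eq[OF card_channel(1)])
  have cardA: "card (A n) = 4 ^ n" for n
    unfolding A_def by (simp add: card_lists_length_eq card_channel)
  have code: "exp (- code_length v) = 1/2 * (1/8) ^ length v" for v
    unfolding code_length_def exp_minus exp_add exp_of_nat_mult by (simp add: field_simps)
  have "R \<subseteq> (\<Union>n\<le>N. A n)"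
  proof
    fix v assume "v \<in> R"
    then have "length v \<le> N" "set v \<subseteq> {e. channel e = i}"
      using assms by (auto simp: N_def)
    then show "v \<in> (\<Union>n\<le>N. A n)"
      by (auto simp: A_def)
  qed
  then have "(\<Sum>v\<in>R. exp (- code_length v)) \<le> (\<Sum>v\<in>(\<Union>n\<le>N. A n). exp (- code_length v))"
    using finA by (intro sum_mono2) auto
  also have "\<dots> = (\<Sum>n\<le>N. \<Sum>v\<in>A n. exp (- code_length v))"
    using finA by (intro sum.UNION_disjoint) (auto simp: A_def)
  also have "\<dots> = (\<Sum>n\<le>N. \<Sum>v\<in>A n. 1/2 * (1/8) ^ n)"
    by (intro sum.cong refl) (auto simp: code A_def)
  also have "\<dots> = 1/2 * (\<Sum>n\<le>N. (1/2) ^ n)"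
    by (simp add: cardA sum_distrib_left power_mult_distrib[symmetric])
  also have "(\<Sum>n\<le>N. (1/2) ^ n) = 2 - (1/2 :: real) ^ N"
    by (induction N) auto
  also have "1/2 * (2 - (1/2 :: real) ^ N) \<le> 1"
    by simp
  finally show ?thesis .
qed

section \<open>Partitions into rectangles\<close>

text \<open>Group the pairs by the value \<open>v\<close> of \<open>\<tau>\<close>; for a fixed block \<open>j\<close>, let
  \<open>a0, a1\<close> (\<open>b0, b1\<close>) count the sets \<open>x\<close> (\<open>y\<close>) compatible with \<open>v\<close> without and with \<open>j\<close>. The
  difference is at most the sum over \<open>v\<close> of \<open>max 0 (a0 - a1) * b1\<close>, hence of
  \<open>max 0 (a0 - a1) * b0 + a0 * max 0 (b1 - b0)\<close>, and each of these two terms involves \<open>j\<close> on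
  one side only.\<close>

lemma rectangle_partition_bound:
  fixes \<tau> :: "'a set \<Rightarrow> 'a set \<Rightarrow> 'v" and g :: "'a set \<Rightarrow> 'a set \<Rightarrow> 'a \<Rightarrow> real" and lam :: "'v \<Rightarrow> real"
  assumes fin: "finite E" and t: "0 \<le> t" "t \<le> 1"
    and rect: "\<And>x y x' y'. \<tau> x y = \<tau> x' y' \<Longrightarrow> \<tau> x y' = \<tau> x y"
    and g01: "\<And>x y j. 0 \<le> g x y j" "\<And>x y j. g x y j \<le> 1"
    and g_cong: "\<And>x x' y j. \<tau> x y = \<tau> x' y \<Longrightarrow> g x y j = g x' y j"
    and kraft: "\<And>R. finite R \<Longrightarrow> R \<subseteq> range (\<lambda>(x, y). \<tau> x y) \<Longrightarrow> (\<Sum>v\<in>R. exp (- lam v)) \<le> 1"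
  shows "t * frame_sum E (\<lambda>x y. \<Sum>j\<in>y. g x y j - g (insert j x) y j)
    \<le> 2 * frame_sum E (\<lambda>x y. lam (\<tau> x y) + t\<^sup>2 * card E)"
proof -
  define R where "R = (\<lambda>(x, y). \<tau> x y) ` (Pow E \<times> Pow E)"
  \<comment> \<open>\<open>inA v\<close> and \<open>inB v\<close> are the sides of the rectangle of
    pairs with value \<open>v\<close>.\<close>
  define inA where "inA v x \<longleftrightarrow> (\<exists>y. \<tau> x y = v)" for v x
  define inB where "inB v y \<longleftrightarrow> (\<exists>x. \<tau> x y = v)" for v y
  define \<alpha> where "\<alpha> V v = (\<Sum>x\<in>Pow V. of_bool (inA v x) :: real)" for V v
  define \<alpha>1 where "\<alpha>1 V j v = (\<Sum>x\<in>Pow V. of_bool (inA v (insert j x)) :: real)" for V j v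
  define \<beta> where "\<beta> W v = (\<Sum>y\<in>Pow W. of_bool (inB v y) :: real)" for W v
  define \<beta>1 where "\<beta>1 W j v = (\<Sum>y\<in>Pow W. of_bool (inB v (insert j y)) :: real)" for W j v
  \<comment> \<open>By \<open>g_cong\<close> any \<open>x\<close> compatible with \<open>v\<close>
    and \<open>y\<close> may represent the value of \<open>g\<close>.\<close>
  define G where "G j v y = g (SOME x. \<tau> x y = v) y j" for j v y
  define \<gamma> where "\<gamma> W j v = (\<Sum>y\<in>Pow W. of_bool (inB v (insert j y)) * G j v (insert j y))" for W j v
  \<comment> \<open>Majority guesses: \<open>\<sigma>\<close> guesses \<open>j \<notin> x\<close> if
    more compatible sets lack \<open>j\<close>, \<open>\<rho>\<close> guesses
    \<open>j \<in> y\<close> if more contain it; both abstain otherwise.\<close>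
  define \<sigma> where "\<sigma> V v j = (- of_bool (\<alpha>1 (V - {j}) j v < \<alpha> (V - {j}) v) :: real)" for V v j
  define \<rho> where "\<rho> W v j = (of_bool (\<beta> (W - {j}) v < \<beta>1 (W - {j}) j v) :: real)" for W v j

  have finR: "finite R" using fin by (simp add: R_def)
  have rect_iff: "\<tau> x y = v \<longleftrightarrow> inA v x \<and> inB v y" for x y v
    unfolding inA_def inB_def using rect by metis
  \<comment> \<open>Each pair lies in exactly one rectangle, whose indicator is a product, so double
    sums split into products over the two sides.\<close>
  have group: "(\<Sum>x\<in>X. \<Sum>y\<in>Y. \<phi> (\<tau> (p x) (q y)) (q y))
      = (\<Sum>v\<in>R. (\<Sum>x\<in>X. of_bool (inA v (p x))) * (\<Sum>y\<in>Y. of_bool (inB v (q y)) * \<phi> v (q y)))"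
    if "p ` X \<subseteq> Pow E" "q ` Y \<subseteq> Pow E"
    for X Y :: "'a set set" and p q and \<phi> :: "'v \<Rightarrow> 'a set \<Rightarrow> real"
  proof -
    have "\<phi> (\<tau> (p x) (q y)) (q y) = (\<Sum>v\<in>R. of_bool (inA v (p x)) * (of_bool (inB v (q y)) * \<phi> v (q y)))"
      if "x \<in> X" "y \<in> Y" for x y
    proof -
      have "\<tau> (p x) (q y) \<in> R"
        using that \<open>p ` X \<subseteq> Pow E\<close> \<open>q ` Y \<subseteq> Pow E\<close>
        unfolding R_def by (intro image_eqI[of _ _ "(p x, q y)"]) auto
      moreover have "of_bool (inA v (p x)) * (of_bool (inB v (q y)) * \<phi> v (q y))
          = (if v = \<tau> (p x) (q y) then \<phi> v (q y) else 0)" for v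
        using rect_iff[of "p x" "q y" v] by auto
      ultimately show ?thesis
        using finR by simp
    qed
    then have "(\<Sum>x\<in>X. \<Sum>y\<in>Y. \<phi> (\<tau> (p x) (q y)) (q y))
      = (\<Sum>x\<in>X. \<Sum>y\<in>Y. \<Sum>v\<in>R. of_bool (inA v (p x)) * (of_bool (inB v (q y)) * \<phi> v (q y)))"
      by simp
    also have "\<dots> = (\<Sum>v\<in>R. \<Sum>x\<in>X. \<Sum>y\<in>Y. of_bool (inA v (p x)) * (of_bool (inB v (q y)) * \<phi> v (q y)))"
      by (simp add: sum.swap[of _ R])
    finally show ?thesis
      by (simp add: sum_product)
  qed
  have group': "(\<Sum>x\<in>X. \<Sum>y\<in>Y. \<phi> (\<tau> (p x) (q y)))
      = (\<Sum>v\<in>R. \<phi> v * ((\<Sum>x\<in>X. of_bool (inA v (p x))) * (\<Sum>y\<in>Y. of_bool (inB v (q y)))))"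
    if "p ` X \<subseteq> Pow E" "q ` Y \<subseteq> Pow E"
    for X Y :: "'a set set" and p q and \<phi> :: "'v \<Rightarrow> real"
    using group[OF that, of "\<lambda>v y. \<phi> v"] by (simp add: sum_distrib_left[symmetric] mult_ac)
  have G_eq: "G j (\<tau> x y) y = g x y j" for j x y
    unfolding G_def by (rule g_cong) (rule someI[of "\<lambda>x'. \<tau> x' y = \<tau> x y" x], simp)

  \<comment> \<open>The frame outside block \<open>j\<close> is fixed. The first prediction adds
    \<open>j\<close> to the frame of \<open>x\<close>, the second adds it to the frame of
    \<open>y\<close>, so each concerns one uniform bit.\<close>
  have local: "(\<Sum>x\<in>Pow V. \<Sum>y\<in>Pow W. g x (insert j y) j - g (insert j x) (insert j y) j)
      \<le> (\<Sum>y\<in>Pow W. \<Sum>x\<in>Pow (insert j V). \<sigma> (insert j V) (\<tau> x y) j * sgn_in j x)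
        + (\<Sum>x\<in>Pow V. \<Sum>y\<in>Pow (insert j W). \<rho> (insert j W) (\<tau> x y) j * sgn_in j y)"
    if j: "j \<in> E" and V: "V \<subseteq> E - {j}" and W: "W \<subseteq> E - {j}" for j V W
  proof -
    have fV: "finite V" and fW: "finite W" and jV: "j \<notin> V" and jW: "j \<notin> W"
      using V W fin by (auto intro: finite_subset)
    have sub: "id ` Pow V \<subseteq> Pow E" "insert j ` Pow V \<subseteq> Pow E" "id ` Pow W \<subseteq> Pow E" "insert j ` Pow W \<subseteq> Pow E"
      using j V W by auto
    define s where "s v = (of_bool (\<alpha>1 V j v < \<alpha> V v) :: real)" for v
    define r where "r v = (of_bool (\<beta> W v < \<beta>1 W j v) :: real)" for v
    have nonneg: "0 \<le> \<alpha>1 V j v" "0 \<le> \<alpha> V v" "0 \<le> \<beta> W v" "0 \<le> \<gamma> W j v" for v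
      by (auto simp: \<alpha>1_def \<alpha>_def \<beta>_def \<gamma>_def G_def g01 intro!: sum_nonneg)
    have \<gamma>_le: "\<gamma> W j v \<le> \<beta>1 W j v" for v
      unfolding \<gamma>_def \<beta>1_def by (intro sum_mono) (auto simp: G_def g01)
    have "(\<Sum>x\<in>Pow V. \<Sum>y\<in>Pow W. g x (insert j y) j - g (insert j x) (insert j y) j)
        = (\<Sum>v\<in>R. (\<alpha> V v - \<alpha>1 V j v) * \<gamma> W j v)"
      using group[OF sub(1) sub(4), of "G j"] group[OF sub(2) sub(4), of "G j"]
      by (simp add: G_eq sum_subtractf \<alpha>_def \<alpha>1_def \<gamma>_def left_diff_distrib)
    also have "\<dots> \<le> (\<Sum>v\<in>R. s v * (\<alpha> V v - \<alpha>1 V j v) * \<beta> W v + r v * \<alpha> V v * (\<beta>1 W j v - \<beta> W v))"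
    proof (rule sum_mono)
      fix v
      show "(\<alpha> V v - \<alpha>1 V j v) * \<gamma> W j v
        \<le> s v * (\<alpha> V v - \<alpha>1 V j v) * \<beta> W v + r v * \<alpha> V v * (\<beta>1 W j v - \<beta> W v)"
      proof (cases "\<alpha>1 V j v < \<alpha> V v")
        case True
        \<comment> \<open>\<open>\<gamma>\<close> is raised to \<open>\<beta>1\<close>, which is
          split into \<open>\<beta>\<close> and \<open>\<beta>1 - \<beta>\<close>.\<close>
        then have "(\<alpha> V v - \<alpha>1 V j v) * \<gamma> W j v \<le> (\<alpha> V v - \<alpha>1 V j v) * \<beta>1 W j v"
          using \<gamma>_le by (intro mult_left_mono) auto
        moreover have "(\<alpha> V v - \<alpha>1 V j v) * (\<beta>1 W j v - \<beta> W v) \<le> r v * \<alpha> V v * (\<beta>1 W j v - \<beta> W v)"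
        proof (cases "\<beta> W v < \<beta>1 W j v")
          case True
          then show ?thesis
            using nonneg[of v] by (auto simp: r_def intro!: mult_right_mono)
        next
          case False
          then show ?thesis
            using \<open>\<alpha>1 V j v < \<alpha> V v\<close> by (auto simp: r_def mult_nonneg_nonpos)
        qed
        ultimately show ?thesis
          using True by (simp add: s_def algebra_simps)
      next
        case False
        then have "(\<alpha> V v - \<alpha>1 V j v) * \<gamma> W j v \<le> 0"
          using nonneg[of v] by (intro mult_nonpos_nonneg) auto
        moreover have "0 \<le> r v * \<alpha> V v * (\<beta>1 W j v - \<beta> W v)"
          using nonneg[of v] by (simp add: r_def)
        ultimately show ?thesis
          using False by (simp add: s_def)
      qed
    qed
    also have "\<dots> = (\<Sum>v\<in>R. s v * (\<alpha> V v - \<alpha>1 V j v) * \<beta> W v) + (\<Sum>v\<in>R. r v * \<alpha> V v * (\<beta>1 W j v - \<beta> W v))"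
      by (rule sum.distrib)
    \<comment> \<open>The signed count is the agreement of the guess \<open>- s\<close> with the
      sign of \<open>j\<close>: sets without \<open>j\<close> enter with \<open>s\<close>, sets with
      \<open>j\<close> with \<open>- s\<close>.\<close>
    also have "(\<Sum>v\<in>R. s v * (\<alpha> V v - \<alpha>1 V j v) * \<beta> W v)
        = (\<Sum>y\<in>Pow W. \<Sum>x\<in>Pow V. s (\<tau> x y) - s (\<tau> (insert j x) y))"
      unfolding sum.swap[of _ "Pow V" "Pow W"]
      using group'[OF sub(1) sub(3), of s] group'[OF sub(2) sub(3), of s]
      by (simp add: sum_subtractf \<alpha>_def \<alpha>1_def \<beta>_def algebra_simps)
    also have "\<dots> = (\<Sum>y\<in>Pow W. \<Sum>x\<in>Pow (insert j V). \<sigma> (insert j V) (\<tau> x y) j * sgn_in j x)"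
      unfolding sum_Pow_insert[OF fV jV] using jV
      by (intro sum.cong refl) (auto simp: \<sigma>_def s_def)
    also have "(\<Sum>v\<in>R. r v * \<alpha> V v * (\<beta>1 W j v - \<beta> W v))
        = (\<Sum>x\<in>Pow V. \<Sum>y\<in>Pow W. r (\<tau> x (insert j y)) - r (\<tau> x y))"
      using group'[OF sub(1) sub(4), of r] group'[OF sub(1) sub(3), of r]
      by (simp add: sum_subtractf \<alpha>_def \<beta>1_def \<beta>_def algebra_simps)
    also have "\<dots> = (\<Sum>x\<in>Pow V. \<Sum>y\<in>Pow (insert j W). \<rho> (insert j W) (\<tau> x y) j * sgn_in j y)"
      unfolding sum_Pow_insert[OF fW jW] using jW
      by (intro sum.cong refl) (auto simp: \<rho>_def r_def)
    finally show ?thesis .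
  qed

  have fin_sub: "finite W" if "W \<subseteq> E" for W
    using that fin by (rule finite_subset)
  \<comment> \<open>For a fixed frame, the values of \<open>\<tau>\<close> serve as code words, once
    predicting \<open>x\<close> and once predicting \<open>y\<close>.\<close>
  have x_side: "t * (\<Sum>y\<in>Pow (E - V). \<Sum>x\<in>Pow V. \<Sum>j\<in>V. \<sigma> V (\<tau> x y) j * sgn_in j x)
      \<le> (\<Sum>y\<in>Pow (E - V). \<Sum>x\<in>Pow V. lam (\<tau> x y) + t\<^sup>2 * card E)" if "V \<subseteq> E" for V
  proof -
    have "t * (\<Sum>y\<in>Pow (E - V). \<Sum>x\<in>Pow V. \<Sum>j\<in>V. \<sigma> V (\<tau> x y) j * sgn_in j x)
      \<le> (\<Sum>y\<in>Pow (E - V). \<Sum>x\<in>Pow V. lam (\<tau> x y) + t\<^sup>2 * card V)"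
      using fin fin_sub[OF that] t by (intro code_prediction_bound kraft) (auto simp: \<sigma>_def)
    also have "\<dots> \<le> (\<Sum>y\<in>Pow (E - V). \<Sum>x\<in>Pow V. lam (\<tau> x y) + t\<^sup>2 * card E)"
      using card_mono[OF fin that] by (intro sum_mono) (simp add: mult_left_mono)
    finally show ?thesis .
  qed
  have y_side: "t * (\<Sum>x\<in>Pow (E - W). \<Sum>y\<in>Pow W. \<Sum>j\<in>W. \<rho> W (\<tau> x y) j * sgn_in j y)
      \<le> (\<Sum>x\<in>Pow (E - W). \<Sum>y\<in>Pow W. lam (\<tau> x y) + t\<^sup>2 * card E)" if "W \<subseteq> E" for W
  proof -
    have "t * (\<Sum>x\<in>Pow (E - W). \<Sum>y\<in>Pow W. \<Sum>j\<in>W. \<rho> W (\<tau> x y) j * sgn_in j y)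
      \<le> (\<Sum>x\<in>Pow (E - W). \<Sum>y\<in>Pow W. lam (\<tau> x y) + t\<^sup>2 * card W)"
      using fin fin_sub[OF that] t
      by (intro code_prediction_bound[where \<tau> = "\<lambda>y x. \<tau> x y"] kraft) (auto simp: \<rho>_def)
    also have "\<dots> \<le> (\<Sum>x\<in>Pow (E - W). \<Sum>y\<in>Pow W. lam (\<tau> x y) + t\<^sup>2 * card E)"
      using card_mono[OF fin that] by (intro sum_mono) (simp add: mult_left_mono)
    finally show ?thesis .
  qed

  have "(\<Sum>W\<in>Pow E. \<Sum>x\<in>Pow (E - W). \<Sum>y\<in>Pow W. \<Sum>j\<in>y. g x y j - g (insert j x) y j)
      = (\<Sum>W\<in>Pow E. \<Sum>x\<in>Pow (E - W). \<Sum>j\<in>W. \<Sum>y\<in>Pow (W - {j}).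
           g x (insert j y) j - g (insert j x) (insert j y) j)"
    using fin_sub by (intro sum.cong refl sum_insert_swap[symmetric]) auto
  also have "\<dots> = (\<Sum>W\<in>Pow E. \<Sum>j\<in>W. \<Sum>x\<in>Pow (E - W). \<Sum>y\<in>Pow (W - {j}).
           g x (insert j y) j - g (insert j x) (insert j y) j)"
    by (intro sum.cong refl sum.swap)
  also have "\<dots> = (\<Sum>j\<in>E. \<Sum>W\<in>Pow (E - {j}). \<Sum>x\<in>Pow (E - insert j W). \<Sum>y\<in>Pow W.
           g x (insert j y) j - g (insert j x) (insert j y) j)"
    by (subst sum_insert_swap[OF fin, symmetric, where f = "\<lambda>W j. \<Sum>x\<in>Pow (E - W). \<Sum>y\<in>Pow (W - {j}).
           g x (insert j y) j - g (insert j x) (insert j y) j"]) (intro sum.cong refl, auto)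
  also have "\<dots> \<le> (\<Sum>j\<in>E. \<Sum>W\<in>Pow (E - {j}).
        (\<Sum>y\<in>Pow W. \<Sum>x\<in>Pow (insert j (E - insert j W)). \<sigma> (insert j (E - insert j W)) (\<tau> x y) j * sgn_in j x)
        + (\<Sum>x\<in>Pow (E - insert j W). \<Sum>y\<in>Pow (insert j W). \<rho> (insert j W) (\<tau> x y) j * sgn_in j y))"
  proof (rule sum_mono, rule sum_mono)
    fix j W assume "j \<in> E" "W \<in> Pow (E - {j})"
    then show "(\<Sum>x\<in>Pow (E - insert j W). \<Sum>y\<in>Pow W. g x (insert j y) j - g (insert j x) (insert j y) j)
      \<le> (\<Sum>y\<in>Pow W. \<Sum>x\<in>Pow (insert j (E - insert j W)). \<sigma> (insert j (E - insert j W)) (\<tau> x y) j * sgn_in j x)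
        + (\<Sum>x\<in>Pow (E - insert j W). \<Sum>y\<in>Pow (insert j W). \<rho> (insert j W) (\<tau> x y) j * sgn_in j y)"
      using local[of j "E - insert j W" W] by blast
  qed
  also have "\<dots> = (\<Sum>j\<in>E. \<Sum>W\<in>Pow (E - {j}).
        \<Sum>y\<in>Pow W. \<Sum>x\<in>Pow (insert j (E - insert j W)). \<sigma> (insert j (E - insert j W)) (\<tau> x y) j * sgn_in j x)
        + (\<Sum>j\<in>E. \<Sum>W\<in>Pow (E - {j}).
        \<Sum>x\<in>Pow (E - insert j W). \<Sum>y\<in>Pow (insert j W). \<rho> (insert j W) (\<tau> x y) j * sgn_in j y)"
    by (simp add: sum.distrib)
  finally have decomp: "(\<Sum>W\<in>Pow E. \<Sum>x\<in>Pow (E - W). \<Sum>y\<in>Pow W. \<Sum>j\<in>y. g x y j - g (insert j x) y j)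
      \<le> (\<Sum>j\<in>E. \<Sum>W\<in>Pow (E - {j}).
        \<Sum>y\<in>Pow W. \<Sum>x\<in>Pow (insert j (E - insert j W)). \<sigma> (insert j (E - insert j W)) (\<tau> x y) j * sgn_in j x)
        + (\<Sum>j\<in>E. \<Sum>W\<in>Pow (E - {j}).
        \<Sum>x\<in>Pow (E - insert j W). \<Sum>y\<in>Pow (insert j W). \<rho> (insert j W) (\<tau> x y) j * sgn_in j y)" .
  have \<rho>_eq: "(\<Sum>j\<in>E. \<Sum>W\<in>Pow (E - {j}).
        \<Sum>x\<in>Pow (E - insert j W). \<Sum>y\<in>Pow (insert j W). \<rho> (insert j W) (\<tau> x y) j * sgn_in j y)
      = (\<Sum>W\<in>Pow E. \<Sum>x\<in>Pow (E - W). \<Sum>y\<in>Pow W. \<Sum>j\<in>W. \<rho> W (\<tau> x y) j * sgn_in j y)"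
    unfolding sum_insert_swap[OF fin, where f = "\<lambda>W j. \<Sum>x\<in>Pow (E - W). \<Sum>y\<in>Pow W. \<rho> W (\<tau> x y) j * sgn_in j y"]
    by (rule sum.cong[OF refl], subst sum.swap, rule sum.cong[OF refl], rule sum.swap)
  \<comment> \<open>On this side \<open>j\<close> belongs to the frame of \<open>x\<close>, so the
    summation passes to complements inside \<open>E - {j}\<close> before \<open>j\<close> is put
    back.\<close>
  have "(\<Sum>j\<in>E. \<Sum>W\<in>Pow (E - {j}).
        \<Sum>y\<in>Pow W. \<Sum>x\<in>Pow (insert j (E - insert j W)). \<sigma> (insert j (E - insert j W)) (\<tau> x y) j * sgn_in j x)
      = (\<Sum>j\<in>E. \<Sum>V\<in>Pow (E - {j}).
        \<Sum>y\<in>Pow (E - insert j V). \<Sum>x\<in>Pow (insert j V). \<sigma> (insert j V) (\<tau> x y) j * sgn_in j x)"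
    (is "(\<Sum>j\<in>E. ?l j) = (\<Sum>j\<in>E. ?r j)")
  proof (rule sum.cong[OF refl])
    fix j
    have "?r j = (\<Sum>V\<in>Pow (E - {j}). \<Sum>y\<in>Pow ((E - {j}) - V). \<Sum>x\<in>Pow (insert j ((E - {j}) - ((E - {j}) - V))).
        \<sigma> (insert j ((E - {j}) - ((E - {j}) - V))) (\<tau> x y) j * sgn_in j x)"
    proof (rule sum.cong[OF refl])
      fix V assume "V \<in> Pow (E - {j})"
      then have "E - insert j V = E - {j} - V" "E - {j} - (E - {j} - V) = V"
        by auto
      then show "(\<Sum>y\<in>Pow (E - insert j V). \<Sum>x\<in>Pow (insert j V). \<sigma> (insert j V) (\<tau> x y) j * sgn_in j x)
        = (\<Sum>y\<in>Pow ((E - {j}) - V). \<Sum>x\<in>Pow (insert j ((E - {j}) - ((E - {j}) - V))).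
        \<sigma> (insert j ((E - {j}) - ((E - {j}) - V))) (\<tau> x y) j * sgn_in j x)"
        by simp
    qed
    also have "\<dots> = (\<Sum>W\<in>Pow (E - {j}). \<Sum>y\<in>Pow W. \<Sum>x\<in>Pow (insert j ((E - {j}) - W)).
        \<sigma> (insert j ((E - {j}) - W)) (\<tau> x y) j * sgn_in j x)"
      by (rule sum_Pow_complement)
    also have "\<dots> = ?l j"
    proof (rule sum.cong[OF refl])
      fix W
      have "E - insert j W = E - {j} - W" by auto
      then show "(\<Sum>y\<in>Pow W. \<Sum>x\<in>Pow (insert j ((E - {j}) - W)).
        \<sigma> (insert j ((E - {j}) - W)) (\<tau> x y) j * sgn_in j x)
        = (\<Sum>y\<in>Pow W. \<Sum>x\<in>Pow (insert j (E - insert j W)).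
        \<sigma> (insert j (E - insert j W)) (\<tau> x y) j * sgn_in j x)"
        by (simp only:)
    qed
    finally show "?l j = ?r j" by simp
  qed
  also have "\<dots> = (\<Sum>V\<in>Pow E. \<Sum>y\<in>Pow (E - V). \<Sum>x\<in>Pow V. \<Sum>j\<in>V. \<sigma> V (\<tau> x y) j * sgn_in j x)"
    unfolding sum_insert_swap[OF fin, where f = "\<lambda>V j. \<Sum>y\<in>Pow (E - V). \<Sum>x\<in>Pow V. \<sigma> V (\<tau> x y) j * sgn_in j x"]
    by (rule sum.cong[OF refl], subst sum.swap, rule sum.cong[OF refl], rule sum.swap)
  finally have \<sigma>_eq: "(\<Sum>j\<in>E. \<Sum>W\<in>Pow (E - {j}).
        \<Sum>y\<in>Pow W. \<Sum>x\<in>Pow (insert j (E - insert j W)). \<sigma> (insert j (E - insert j W)) (\<tau> x y) j * sgn_in j x)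
      = (\<Sum>V\<in>Pow E. \<Sum>y\<in>Pow (E - V). \<Sum>x\<in>Pow V. \<Sum>j\<in>V. \<sigma> V (\<tau> x y) j * sgn_in j x)" .
  have "t * (\<Sum>W\<in>Pow E. \<Sum>x\<in>Pow (E - W). \<Sum>y\<in>Pow W. \<Sum>j\<in>y. g x y j - g (insert j x) y j)
    \<le> t * ((\<Sum>V\<in>Pow E. \<Sum>y\<in>Pow (E - V). \<Sum>x\<in>Pow V. \<Sum>j\<in>V. \<sigma> V (\<tau> x y) j * sgn_in j x)
      + (\<Sum>W\<in>Pow E. \<Sum>x\<in>Pow (E - W). \<Sum>y\<in>Pow W. \<Sum>j\<in>W. \<rho> W (\<tau> x y) j * sgn_in j y))"
    using decomp t(1) unfolding \<rho>_eq \<sigma>_eq by (rule mult_left_mono)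
  also have "\<dots> \<le> (\<Sum>V\<in>Pow E. \<Sum>y\<in>Pow (E - V). \<Sum>x\<in>Pow V. lam (\<tau> x y) + t\<^sup>2 * card E)
      + (\<Sum>W\<in>Pow E. \<Sum>x\<in>Pow (E - W). \<Sum>y\<in>Pow W. lam (\<tau> x y) + t\<^sup>2 * card E)"
    unfolding distrib_left sum_distrib_left[of t _ "Pow E"]
    by (intro add_mono sum_mono x_side y_side) auto
  finally have bound: "t * (\<Sum>W\<in>Pow E. \<Sum>x\<in>Pow (E - W). \<Sum>y\<in>Pow W. \<Sum>j\<in>y. g x y j - g (insert j x) y j)
      \<le> (\<Sum>V\<in>Pow E. \<Sum>y\<in>Pow (E - V). \<Sum>x\<in>Pow V. lam (\<tau> x y) + t\<^sup>2 * card E)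
      + (\<Sum>W\<in>Pow E. \<Sum>x\<in>Pow (E - W). \<Sum>y\<in>Pow W. lam (\<tau> x y) + t\<^sup>2 * card E)" .
  \<comment> \<open>Taking \<open>W = E - V\<close> turns the bound for the \<open>x\<close> side
    into the same frame sum as for the \<open>y\<close> side, whence the factor 2.\<close>
  have "(\<Sum>V\<in>Pow E. \<Sum>y\<in>Pow (E - V). \<Sum>x\<in>Pow V. lam (\<tau> x y) + t\<^sup>2 * card E)
      = (\<Sum>V\<in>Pow E. \<Sum>x\<in>Pow (E - (E - V)). \<Sum>y\<in>Pow (E - V). lam (\<tau> x y) + t\<^sup>2 * card E)"
  proof (rule sum.cong[OF refl])
    fix V assume "V \<in> Pow E"
    then have "E - (E - V) = V" by auto
    then show "(\<Sum>y\<in>Pow (E - V). \<Sum>x\<in>Pow V. lam (\<tau> x y) + t\<^sup>2 * card E)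
      = (\<Sum>x\<in>Pow (E - (E - V)). \<Sum>y\<in>Pow (E - V). lam (\<tau> x y) + t\<^sup>2 * card E)"
      by (simp add: sum.swap[of _ "Pow V" "Pow (E - V)"])
  qed
  also have "\<dots> = (\<Sum>W\<in>Pow E. \<Sum>x\<in>Pow (E - W). \<Sum>y\<in>Pow W. lam (\<tau> x y) + t\<^sup>2 * card E)"
    by (rule sum_Pow_complement)
  finally show ?thesis
    using bound unfolding frame_sum_def by simp
qed

section \<open>Histories of protocols\<close>

lemma channel_view: "e \<in> set (view i h) \<Longrightarrow> channel e = i"
  by (simp add: view_def)

text \<open>The condition reads the view of one channel instead of the whole history, so the input
  of one site can be exchanged without affecting the conditions on the others.\<close>

definition site_ok :: "'a protocol \<Rightarrow> nat \<Rightarrow> ('a \<Rightarrow> real) \<Rightarrow> event list \<Rightarrow> bool" where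
  "site_ok \<pi> i z v \<longleftrightarrow> (\<forall>v1 b v2. v = v1 @ To_Coord i b # v2 \<longrightarrow> b = site \<pi> i z v1)"

text \<open>After \<open>Receive\<close> the bit is left free; this keeps \<open>coord_ok\<close>
  independent of the input.\<close>

definition coord_step :: "'a protocol \<Rightarrow> event list \<Rightarrow> event \<Rightarrow> bool" where
  "coord_step \<pi> h e \<longleftrightarrow> (\<exists>i b. coord \<pi> h = Send i b \<and> e = To_Site i b \<or> coord \<pi> h = Receive i \<and> e = To_Coord i b)"

definition coord_ok :: "'a protocol \<Rightarrow> event list \<Rightarrow> bool" where
  "coord_ok \<pi> h \<longleftrightarrow> (\<forall>h1 e h2. h = h1 @ e # h2 \<longrightarrow> coord_step \<pi> h1 e)"

lemma snoc_eq_append_Cons: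
  "xs @ [x] = ys @ y # zs \<longleftrightarrow> (zs = [] \<and> ys = xs \<and> y = x) \<or> (\<exists>zs'. zs = zs' @ [x] \<and> xs = ys @ y # zs')"
  by (cases zs rule: rev_cases) auto

lemma coord_ok_snoc: "coord_ok \<pi> (h @ [e]) \<longleftrightarrow> coord_ok \<pi> h \<and> coord_step \<pi> h e"
  unfolding coord_ok_def snoc_eq_append_Cons by blast

lemma site_ok_snoc:
  "site_ok \<pi> i z (v @ [e]) \<longleftrightarrow> site_ok \<pi> i z v \<and> (\<forall>b. e = To_Coord i b \<longrightarrow> b = site \<pi> i z v)"
  unfolding site_ok_def snoc_eq_append_Cons by blast

lemma run_snoc_iff:
  "run \<pi> x (h @ [e]) \<longleftrightarrow>
    run \<pi> x h \<and> coord_step \<pi> h e \<and> (\<forall>i b. e = To_Coord i b \<longrightarrow> b = site \<pi> i (x i) (view i h))"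
proof
  assume "run \<pi> x (h @ [e])"
  then show "run \<pi> x h \<and> coord_step \<pi> h e \<and> (\<forall>i b. e = To_Coord i b \<longrightarrow> b = site \<pi> i (x i) (view i h))"
    by (cases rule: run.cases) (auto simp: coord_step_def)
next
  assume "run \<pi> x h \<and> coord_step \<pi> h e \<and> (\<forall>i b. e = To_Coord i b \<longrightarrow> b = site \<pi> i (x i) (view i h))"
  then show "run \<pi> x (h @ [e])"
    by (auto simp: coord_step_def intro: run.send run.receive)
qed

text \<open>The rectangle property: the inputs with a given history form a product set.\<close>

lemma run_iff: "run \<pi> x h \<longleftrightarrow> coord_ok \<pi> h \<and> (\<forall>i. site_ok \<pi> i (x i) (view i h))"
proof (induction h rule: rev_induct)
  case Nil
  then show ?case
    by (simp add: run.start coord_ok_def site_ok_def view_def)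
next
  case (snoc e h)
  have "site_ok \<pi> i (x i) (view i (h @ [e])) \<longleftrightarrow>
      site_ok \<pi> i (x i) (view i h) \<and> (\<forall>b. e = To_Coord i b \<longrightarrow> b = site \<pi> i (x i) (view i h))" for i
  proof (cases "channel e = i")
    case True
    then have "view i (h @ [e]) = view i h @ [e]"
      by (simp add: view_def)
    then show ?thesis
      by (simp add: site_ok_snoc)
  next
    case False
    then have "view i (h @ [e]) = view i h" "\<And>b. e \<noteq> To_Coord i b"
      by (auto simp: view_def)
    then show ?thesis
      by simp
  qed
  then show ?case
    using snoc by (auto simp: run_snoc_iff coord_ok_snoc)
qed

lemma run_append: "run \<pi> x (h @ h') \<Longrightarrow> run \<pi> x h"
proof (induction h' rule: rev_induct)
  case (snoc e h')
  then show ?case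
    using run_snoc_iff[of \<pi> x "h @ h'" e] by simp
qed simp

text \<open>Determinism: the coordinator fixes the channel and direction of the next event, and its
  bit is fixed by the coordinator or by the site.\<close>

lemma run_same_length:
  assumes "run \<pi> x h" "run \<pi> x h'" "length h = length h'"
  shows "h = h'"
  using assms
proof (induction h arbitrary: h' rule: rev_induct)
  case (snoc e h)
  then obtain e' h'' where h': "h' = h'' @ [e']" "length h'' = length h"
    by (cases h' rule: rev_cases) auto
  have r: "run \<pi> x (h @ [e])" "run \<pi> x (h'' @ [e'])"
    using snoc.prems h' by auto
  then have "h = h''"
    using snoc.IH[of h''] h'(2) unfolding run_snoc_iff by simp
  then have "e = e'"
  proof (cases "coord \<pi> h")
    case (Send i b)
    then show ?thesis
      using r \<open>h = h''\<close> by (auto simp: run_snoc_iff coord_step_def)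
  next
    case (Receive i)
    then obtain b b' where "e = To_Coord i b" "e' = To_Coord i b'"
      using r \<open>h = h''\<close> by (auto simp: run_snoc_iff coord_step_def)
    then show ?thesis
      using r \<open>h = h''\<close> by (simp add: run_snoc_iff)
  next
    case (Output C)
    then show ?thesis
      using r \<open>h = h''\<close> by (auto simp: run_snoc_iff coord_step_def)
  qed
  with \<open>h = h''\<close> show ?case
    using h' by simp
qed simp

section \<open>Complete histories and cut-and-paste\<close>

definition halts_with :: "'a protocol \<Rightarrow> (nat \<Rightarrow> 'a \<Rightarrow> real) \<Rightarrow> event list \<Rightarrow> bool" where
  "halts_with \<pi> x h \<longleftrightarrow> run \<pi> x h \<and> (\<exists>C. coord \<pi> h = Output C)"

text \<open>By determinism the shorter history is a prefix of the longer one, and no event follows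
  an \<open>Output\<close>.\<close>

lemma halts_with_unique:
  assumes "halts_with \<pi> x h" "halts_with \<pi> x h'"
  shows "h = h'"
proof -
  have *: "h = h'" if "halts_with \<pi> x h" "halts_with \<pi> x h'" "length h \<le> length h'" for h h'
  proof -
    have "run \<pi> x (take (length h) h')"
      using that run_append[of \<pi> x "take (length h) h'" "drop (length h) h'"] by (simp add: halts_with_def)
    then have h: "h = take (length h) h'"
      using that by (intro run_same_length[of \<pi> x]) (auto simp: halts_with_def)
    show ?thesis
    proof (rule ccontr)
      assume "h \<noteq> h'"
      then obtain e r where "h' = h @ e # r"
        using h by (metis append_take_drop_id append_Nil2 neq_Nil_conv)
      then have "coord_step \<pi> h e"
        using that by (auto simp: halts_with_def run_iff coord_ok_def)
      then show False
        using that by (auto simp: halts_with_def coord_step_def)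
    qed
  qed
  show ?thesis
    using *[of h h'] *[of h' h] assms by (cases "length h \<le> length h'") auto
qed

lemma halts_with_exists:
  assumes "\<And>h. run \<pi> x h \<Longrightarrow> length h \<le> B"
  shows "\<exists>h. halts_with \<pi> x h"
proof (rule ccontr)
  assume no: "\<nexists>h. halts_with \<pi> x h"
  have "\<exists>h. run \<pi> x h \<and> length h = n" for n
  proof (induction n)
    case 0
    show ?case
      using run.start by (intro exI[of _ "[]"]) simp
  next
    case (Suc n)
    then obtain h where h: "run \<pi> x h" "length h = n"
      by blast
    show ?case
    proof (cases "coord \<pi> h")
      case (Send i b)
      from run.send[OF h(1) this] h(2) show ?thesis
        by (intro exI[of _ "h @ [To_Site i b]"]) simp
    next
      case (Receive i)
      from run.receive[OF h(1) this] h(2) show ?thesis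
        by (intro exI[of _ "h @ [To_Coord i (site \<pi> i (x i) (view i h))]"]) simp
    next
      case (Output C)
      with no h(1) show ?thesis
        by (simp add: halts_with_def)
    qed
  qed
  from this[of "Suc B"] obtain h where "run \<pi> x h" "length h = Suc B"
    by blast
  with assms[of h] show False
    by simp
qed

text \<open>Cut and paste: on its own channel site \<open>i\<close> sees the same in
  \<open>h\<close> and \<open>h'\<close>, so its input from \<open>x\<close> is compatible with
  \<open>h'\<close> as well. The histories may differ elsewhere.\<close>

lemma halts_with_mix:
  assumes "halts_with \<pi> x h" "halts_with \<pi> x' h'" "view i h = view i h'"
    and "z i = x i" "\<And>l. l \<noteq> i \<Longrightarrow> z l = x' l"
  shows "halts_with \<pi> z h'"
proof -
  have "site_ok \<pi> l (z l) (view l h')" for l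
  proof (cases "l = i")
    case True
    have "site_ok \<pi> i (x i) (view i h)"
      using assms(1) by (simp add: halts_with_def run_iff)
    then show ?thesis
      using True assms(3,4) by simp
  next
    case False
    then show ?thesis
      using assms(2,5) by (simp add: halts_with_def run_iff)
  qed
  then show ?thesis
    using assms(2) by (auto simp: halts_with_def run_iff)
qed

definition history :: "'a protocol \<Rightarrow> (nat \<Rightarrow> 'a \<Rightarrow> real) \<Rightarrow> event list" where
  "history \<pi> x = (THE h. halts_with \<pi> x h)"

lemma history_eqI: "halts_with \<pi> x h \<Longrightarrow> history \<pi> x = h"
  unfolding history_def using halts_with_unique by (intro the_equality) auto

lemma outputs_history:
  assumes "halts_with \<pi> x (history \<pi> x)" "outputs \<pi> x C"
  shows "coord \<pi> (history \<pi> x) = Output C"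
proof -
  obtain h where "run \<pi> x h" "coord \<pi> h = Output C"
    using assms(2) by (auto simp: outputs_def)
  then show ?thesis
    using history_eqI[of \<pi> x h] by (auto simp: halts_with_def)
qed

lemma channel_run:
  assumes "uses_sites s \<pi>" "run \<pi> x h" "e \<in> set h"
  shows "channel e < s"
proof -
  obtain h1 h2 where "h = h1 @ e # h2"
    using assms(3) by (meson split_list)
  then have "coord_step \<pi> h1 e"
    using assms(2) by (simp add: run_iff coord_ok_def)
  then show ?thesis
    using assms(1) unfolding coord_step_def uses_sites_def by (metis channel.simps)
qed

text \<open>Each event lies on one channel, hence in at most one of the views.\<close>

lemma sum_length_view_le:
  assumes "finite I"
  shows "(\<Sum>i\<in>I. length (view i h)) \<le> length h"
proof (induction h)
  case Nil
  then show ?case by (simp add: view_def)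
next
  case (Cons e h)
  have "(\<Sum>i\<in>I. length (view i (e # h))) = (\<Sum>i\<in>I. length (view i h) + (if channel e = i then 1 else 0))"
    by (intro sum.cong) (auto simp: view_def)
  also have "\<dots> \<le> length (e # h)"
    using Cons assms by (simp add: sum.distrib)
  finally show ?case .
qed

section \<open>The metric space and averaging over coins\<close>

text \<open>The point \<open>p\<close> is the copy of location \<open>p div s\<close> for site
  \<open>p mod s\<close>. Separate copies keep the inputs of the sites disjoint even if they hold
  the same location.\<close>

definition loc_dist :: "nat \<Rightarrow> nat \<Rightarrow> nat \<Rightarrow> nat \<Rightarrow> real" where
  "loc_dist s k p q = (if p = q then 0 else if p div s = q div s then 1 / (8 * real k * real s) else 1)"

definition site_input :: "nat \<Rightarrow> (nat \<Rightarrow> nat set) \<Rightarrow> nat \<Rightarrow> nat \<Rightarrow> real" where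
  "site_input s T i p = (if p mod s = i \<and> p div s \<in> T i then 1 else 0)"

text \<open>Sharing a location is an equivalence relation, so a triangle with a side between two
  locations has a second such side; the rest follows from \<open>\<epsilon> \<le> 1\<close>.\<close>

lemma Metric_space_loc_dist:
  assumes "1 \<le> s" "1 \<le> k"
  shows "Metric_space S (loc_dist s k)"
proof -
  define \<epsilon> where "\<epsilon> = 1 / (8 * real k * real s)"
  have "1 * 1 \<le> k * s"
    using assms by (intro mult_mono) auto
  then have "1 \<le> real k * real s"
    by (metis mult_1 of_nat_1 of_nat_le_iff of_nat_mult)
  then have "0 < \<epsilon>" "\<epsilon> \<le> 1"
    by (auto simp: \<epsilon>_def field_simps)
  then show ?thesis
    unfolding loc_dist_def \<epsilon>_def[symmetric] by unfold_locales auto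
qed

lemma site_input_points_subset:
  assumes "1 \<le> s" "T i \<subseteq> {..<n}"
  shows "points (site_input s T i) \<subseteq> {..<n * s}"
proof
  fix p assume "p \<in> points (site_input s T i)"
  then have "p div s < n"
    using assms by (auto simp: points_def site_input_def split: if_splits)
  then show "p \<in> {..<n * s}"
    using assms by (simp add: div_less_iff_less_mult)
qed

lemma distributed_site_input:
  assumes "1 \<le> s" "\<And>i. i < s \<Longrightarrow> T i \<subseteq> {..<n}"
  shows "distributed_input weighted {..<n * s} s (site_input s T)"
proof -
  have "disjoint_family_on (\<lambda>i. points (site_input s T i)) {..<s}"
    by (auto simp: disjoint_family_on_def points_def site_input_def split: if_splits)
  moreover have "points (site_input s T i) \<subseteq> {..<n * s}" if "i < s" for i
    using assms(1) assms(2)[OF that] by (rule site_input_points_subset)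
  ultimately show ?thesis
    unfolding distributed_input_def by (auto simp: site_input_def intro: finite_subset)
qed

lemma whole_site_input:
  assumes "1 \<le> s"
  shows "whole_input s (site_input s T) p = (if p div s \<in> T (p mod s) then 1 else 0)"
proof -
  have "whole_input s (site_input s T) p = (\<Sum>i<s. if i = p mod s then (if p div s \<in> T (p mod s) then 1 else 0) else 0)"
    unfolding whole_input_def by (intro sum.cong) (auto simp: site_input_def)
  then show ?thesis
    using assms by (simp add: sum.delta)
qed

lemma center_sets_finite: "finite S \<Longrightarrow> finite (center_sets S m)"
  by (rule finite_subset[of _ "Pow S"]) (auto simp: center_sets_def)

lemma center_dist_le: "finite C \<Longrightarrow> q \<in> C \<Longrightarrow> center_dist d p C \<le> d p q"
  by (simp add: center_dist_def)

lemma center_dist_ge: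
  assumes "finite C" "C \<noteq> {}" "\<And>q. q \<in> C \<Longrightarrow> r \<le> d p q"
  shows "r \<le> center_dist d p C"
  using assms by (simp add: center_dist_def)

lemma bicriteria_solution_covers:
  assumes sk: "1 \<le> s" "1 \<le> k" and c: "c \<in> {1..1.01}" and obj: "obj \<in> {kmedian_cost, kmeans_cost}"
    and T: "\<And>i. i < s \<Longrightarrow> T i \<subseteq> {..<4 * k}" and U: "card (\<Union>i<s. T i) \<le> k"
    and sol: "bicriteria_solution (obj (loc_dist s k)) {..<4 * k * s} k (7.1 - 6 * c) c
      (whole_input s (site_input s T)) C"
  shows "card ((\<lambda>p. p div s) ` C) \<le> 1.01 * real k" "(\<Union>i<s. T i) \<subseteq> (\<lambda>p. p div s) ` C"
proof -
  define \<epsilon> where "\<epsilon> = 1 / (8 * real k * real s)"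
  define w where "w = whole_input s (site_input s T)"
  define d where "d = loc_dist s k"
  define U where "U = (\<Union>i<s. T i)"
  have "1 * 1 \<le> k * s"
    using sk by (intro mult_mono) auto
  then have "1 \<le> real k * real s"
    by (metis mult_1 of_nat_1 of_nat_le_iff of_nat_mult)
  then have \<epsilon>: "0 < \<epsilon>" "\<epsilon> \<le> 1"
    by (auto simp: \<epsilon>_def field_simps)
  have d_nonneg: "0 \<le> d p q" for p q
    using \<epsilon> by (simp add: d_def loc_dist_def \<epsilon>_def[symmetric])
  have w: "w p = (if p div s \<in> T (p mod s) then 1 else 0)" for p
    unfolding w_def using sk by (simp add: whole_site_input)
  \<comment> \<open>The exponent \<open>e\<close> treats both objectives at once.\<close>
  obtain e :: nat where e: "e = 1 \<or> e = 2" and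
    cost: "\<And>C. obj d w C = (\<Sum>p\<in>points w. w p * center_dist d p C ^ e)"
  proof (cases "obj = kmedian_cost")
    case True
    then show ?thesis
      by (intro that[of 1]) (simp_all add: kmedian_cost_def)
  next
    case False
    then have "obj = kmeans_cost"
      using obj by simp
    then show ?thesis
      by (intro that[of 2]) (simp_all add: kmeans_cost_def)
  qed
  have pts: "points w = {p. p div s \<in> T (p mod s)}"
    by (auto simp: points_def w)
  have pts_sub: "points w \<subseteq> {..<4 * k * s}"
  proof
    fix p assume "p \<in> points w"
    then have "p div s < 4 * k"
      using T[of "p mod s"] sk by (auto simp: pts)
    then show "p \<in> {..<4 * k * s}"
      using sk by (simp add: div_less_iff_less_mult)
  qed
  then have fin_pts: "finite (points w)"
    by (rule finite_subset) simp
  have C: "finite C" "C \<noteq> {}" "real (card C) \<le> c * k"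
    using sol by (auto simp: bicriteria_solution_def center_sets_def)
  have "real (card ((\<lambda>p. p div s) ` C)) \<le> card C"
    using C by (simp add: card_image_le)
  also have "\<dots> \<le> 1.01 * k"
    using C(3) c by (smt (verit) atLeastAtMost_iff mult_right_mono of_nat_0_le_iff)
  finally show "card ((\<lambda>p. p div s) ` C) \<le> 1.01 * real k" .

  \<comment> \<open>One center per location in use, always the copy of site 0; the default
    \<open>{0}\<close> avoids an empty center set.\<close>
  define C0 where "C0 = (if U = {} then {0} else (\<lambda>l. l * s) ` U)"
  have "U \<subseteq> {..<4 * k}"
    using T by (auto simp: U_def)
  then have finU: "finite U"
    by (rule finite_subset) simp
  have "card ((\<lambda>l. l * s) ` U) \<le> k"
    using card_image_le[OF finU] assms(6) unfolding U_def by (meson order_trans)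
  moreover have "l * s < 4 * k * s" if "l \<in> U" for l
    using that \<open>U \<subseteq> {..<4 * k}\<close> sk by auto
  ultimately have C0: "C0 \<in> center_sets {..<4 * k * s} (real k)"
    using finU sk by (auto simp: C0_def center_sets_def)
  have "obj d w C0 \<le> (\<Sum>p\<in>points w. \<epsilon>)"
    unfolding cost
  proof (rule sum_mono)
    fix p assume p: "p \<in> points w"
    then have "p div s \<in> U"
      using sk by (auto simp: pts U_def)
    then have "(p div s) * s \<in> C0"
      by (auto simp: C0_def)
    then have "center_dist d p C0 \<le> d p ((p div s) * s)"
      using C0 by (intro center_dist_le) (auto simp: center_sets_def)
    also have "\<dots> \<le> \<epsilon>"
      using sk \<epsilon> by (auto simp: d_def loc_dist_def \<epsilon>_def)
    finally have le: "center_dist d p C0 \<le> \<epsilon>" .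
    have ge: "0 \<le> center_dist d p C0"
      using C0 d_nonneg by (intro center_dist_ge) (auto simp: center_sets_def)
    have "center_dist d p C0 ^ e \<le> \<epsilon>"
      using e
    proof
      assume "e = 2"
      moreover have "center_dist d p C0 * center_dist d p C0 \<le> 1 * \<epsilon>"
        using le ge \<epsilon> by (intro mult_mono) auto
      ultimately show ?thesis
        by (simp add: power2_eq_square)
    qed (use le in simp)
    then show "w p * center_dist d p C0 ^ e \<le> \<epsilon>"
      using \<epsilon> by (auto simp: w)
  qed
  also have "\<dots> \<le> 1/2"
  proof -
    have "card (points w) \<le> 4 * k * s"
      using card_mono[OF _ pts_sub] by simp
    then have "real (card (points w)) \<le> 4 * real k * real s"
      by (metis of_nat_le_iff of_nat_mult of_nat_numeral)
    then have "real (card (points w)) * \<epsilon> \<le> (4 * real k * real s) * \<epsilon>"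
      using \<epsilon> by (intro mult_right_mono) auto
    also have "\<dots> = 1/2"
      using sk by (simp add: \<epsilon>_def)
    finally show ?thesis
      by simp
  qed
  finally have "obj d w C0 \<le> 1/2" .
  moreover have "opt_cost (obj d) {..<4 * k * s} k w \<le> obj d w C0"
    unfolding opt_cost_def using C0
    by (intro cINF_lower) (auto intro!: bdd_below_finite center_sets_finite)
  ultimately have "opt_cost (obj d) {..<4 * k * s} k w \<le> 1/2"
    by linarith
  \<comment> \<open>For \<open>c \<ge> 1\<close> the factor is at most 1.1, so the cost is at most
    0.55; \<open>c \<le> 1.01\<close> makes the factor nonnegative.\<close>
  then have "(7.1 - 6 * c) * opt_cost (obj d) {..<4 * k * s} k w \<le> (7.1 - 6 * c) * (1/2)"
    using c by (intro mult_left_mono) auto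
  moreover have "obj d w C \<le> (7.1 - 6 * c) * opt_cost (obj d) {..<4 * k * s} k w"
    using sol by (simp add: bicriteria_solution_def d_def w_def)
  ultimately have "obj d w C \<le> (7.1 - 6 * c) * (1/2)"
    by linarith
  also have "\<dots> < 1"
    using c by auto
  finally have small: "obj d w C < 1" .

  show "(\<Union>i<s. T i) \<subseteq> (\<lambda>p. p div s) ` C"
  proof (rule ccontr)
    assume "\<not> (\<Union>i<s. T i) \<subseteq> (\<lambda>p. p div s) ` C"
    then obtain i l where il: "i < s" "l \<in> T i" "l \<notin> (\<lambda>p. p div s) ` C"
      by auto
    define p where "p = l * s + i"
    have p: "p div s = l" "p mod s = i"
      using il by (auto simp: p_def)
    have "1 \<le> d p q" if "q \<in> C" for q
    proof -
      have "p div s \<noteq> q div s"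
        using that il p by auto
      then show ?thesis
        by (auto simp: d_def loc_dist_def)
    qed
    then have "1 \<le> center_dist d p C"
      using C by (intro center_dist_ge)
    then have "1 \<le> w p * center_dist d p C ^ e"
      using il p by (simp add: w one_le_power)
    also have "\<dots> \<le> obj d w C"
      unfolding cost
    proof (rule member_le_sum[OF _ _ fin_pts])
      show "p \<in> points w"
        using il p by (simp add: pts)
      show "0 \<le> w q * center_dist d q C ^ e" for q
        using C d_nonneg by (intro mult_nonneg_nonneg zero_le_power center_dist_ge) (auto simp: w)
    qed
    finally show False
      using small by simp
  qed
qed

section \<open>Averaging over the coins\<close>

text \<open>In the applications, \<open>w\<close> is the value of \<open>f\<close> if every event
  counted by \<open>f\<close> occurs, and \<open>q\<close> is their guaranteed probability. By
  linearity the bound passes from single inputs to weighted sums over inputs.\<close>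

definition lower_mean :: "'a measure \<Rightarrow> real \<Rightarrow> ('a \<Rightarrow> real) \<Rightarrow> real \<Rightarrow> bool" where
  "lower_mean R q f w \<longleftrightarrow> integrable R f \<and> q * w \<le> integral\<^sup>L R f"

lemma lower_mean_sum:
  assumes "\<And>a. a \<in> A \<Longrightarrow> lower_mean R q (f a) (w a)"
  shows "lower_mean R q (\<lambda>z. \<Sum>a\<in>A. f a z) (\<Sum>a\<in>A. w a)"
  using assms by (auto simp: lower_mean_def sum_distrib_left intro!: sum_mono)

lemma lower_mean_mult:
  assumes "lower_mean R q f w" "0 \<le> c"
  shows "lower_mean R q (\<lambda>z. c * f z) (c * w)"
  using assms mult_left_mono[of "q * w" "integral\<^sup>L R f" c]
  by (auto simp: lower_mean_def mult.left_commute)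

lemma lower_mean_add:
  assumes "lower_mean R q f v" "lower_mean R q g w"
  shows "lower_mean R q (\<lambda>z. f z + g z) (v + w)"
  using assms by (auto simp: lower_mean_def distrib_left)

text \<open>A positive lower bound forces measurability of the event, as other sets have measure
  0.\<close>

lemma lower_mean_of_bool:
  assumes "prob_space R" "0 < q" "q \<le> measure R {z \<in> space R. P z}"
  shows "lower_mean R q (\<lambda>z. of_bool (P z)) 1"
proof -
  interpret prob_space R by fact
  have "{z \<in> space R. P z} \<in> sets R"
    using assms(2,3) measure_notin_sets by fastforce
  then have "integrable R (indicator {z \<in> space R. P z} :: _ \<Rightarrow> real)"
    by (intro integrable_real_indicator) (simp_all add: less_top[symmetric])
  moreover have "indicator {z \<in> space R. P z} z = (of_bool (P z) :: real)" if "z \<in> space R" for z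
    using that by (simp add: indicator_def)
  ultimately have "integrable R (\<lambda>z. of_bool (P z) :: real)"
    and "integral\<^sup>L R (\<lambda>z. of_bool (P z)) = integral\<^sup>L R (indicator {z \<in> space R. P z} :: _ \<Rightarrow> real)"
    by (auto cong: Bochner_Integration.integrable_cong Bochner_Integration.integral_cong)
  then show ?thesis
    using assms \<open>{z \<in> space R. P z} \<in> sets R\<close> by (simp add: lower_mean_def)
qed

lemma lower_mean_le:
  assumes "prob_space R" "lower_mean R q f w" "\<And>z. z \<in> space R \<Longrightarrow> f z \<le> r"
  shows "q * w \<le> r"
proof -
  interpret prob_space R by fact
  have "integral\<^sup>L R f \<le> r"
    using assms by (intro integral_le_const) (auto simp: lower_mean_def)
  then show ?thesis
    using assms(2) by (simp add: lower_mean_def)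
qed

section \<open>Protocols that find the union\<close>

definition one_per_block :: "nat \<Rightarrow> nat set \<Rightarrow> nat set" where
  "one_per_block m y = (\<lambda>j. 2 * j + of_bool (j \<in> y)) ` {..<m}"

lemma inj_on_block: "inj_on (\<lambda>j. 2 * j + of_bool (P j) :: nat) A"
proof (rule inj_onI)
  fix i j :: nat assume "2 * i + of_bool (P i) = 2 * j + of_bool (P j)"
  then have "(2 * i + of_bool (P i)) div 2 = (2 * j + of_bool (P j)) div 2"
    by simp
  then show "i = j"
    by simp
qed

lemma card_one_per_block: "card (one_per_block m y) = m"
  unfolding one_per_block_def by (simp add: card_image inj_on_block)

lemma one_per_block_subset: "one_per_block m y \<subseteq> {..<2 * m}"
  by (auto simp: one_per_block_def)

lemma block_other_notin: "2 * j + of_bool (j \<notin> y) \<notin> one_per_block m y"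
proof
  assume "2 * j + of_bool (j \<notin> y) \<in> one_per_block m y"
  then obtain i where i: "2 * j + of_bool (j \<notin> y) = 2 * i + of_bool (i \<in> y)"
    by (auto simp: one_per_block_def)
  then have "(2 * j + of_bool (j \<notin> y)) div 2 = (2 * i + of_bool (i \<in> y)) div 2"
    by simp
  then have "j = i" by simp
  with i show False by (cases "i \<in> y") auto
qed

text \<open>The unchosen locations in \<open>F\<close> are distinct and come on top of the
  \<open>m\<close> chosen ones. So a cover of size near \<open>m\<close> contains both locations of
  few blocks only.\<close>

lemma card_double_blocks:
  assumes "finite F" "one_per_block m y \<subseteq> F"
  shows "card {j. j < m \<and> 2 * j + of_bool (j \<notin> y) \<in> F} + m \<le> card F"
proof -
  define A where "A = {j. j < m \<and> 2 * j + of_bool (j \<notin> y) \<in> F}"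
  define A' where "A' = (\<lambda>j. 2 * j + of_bool (j \<notin> y)) ` A"
  have "finite A'" "card A' = card A"
    by (simp_all add: A'_def A_def card_image inj_on_block)
  moreover have "A' \<inter> one_per_block m y = {}"
    using block_other_notin by (auto simp: A'_def)
  moreover have "finite (one_per_block m y)"
    by (simp add: one_per_block_def)
  ultimately have "card A + m = card (A' \<union> one_per_block m y)"
    by (simp add: card_Un_disjoint card_one_per_block)
  also have "\<dots> \<le> card F"
    using assms by (intro card_mono) (auto simp: A'_def A_def)
  finally show ?thesis by (simp add: A_def)
qed

text \<open>This fixes one outcome of the coins: \<open>\<pi>\<close> is deterministic, and
  \<open>ok T\<close> stands for its success on the locations \<open>T\<close>. Of the clustering
  problem only the covering of the union remains.\<close>

locale union_protocol =
  fixes s k :: nat and \<pi> :: "nat protocol" and B :: real and ok :: "(nat \<Rightarrow> nat set) \<Rightarrow> bool"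
  assumes s_pos: "1 \<le> s" and k_pos: "1 \<le> k" and uses: "uses_sites s \<pi>"
    and bits: "\<And>T h. (\<And>i. i < s \<Longrightarrow> T i \<subseteq> {..<4 * k}) \<Longrightarrow> run \<pi> (site_input s T) h \<Longrightarrow> length h \<le> B"
    and ok: "\<And>T. (\<And>i. i < s \<Longrightarrow> T i \<subseteq> {..<4 * k}) \<Longrightarrow> card (\<Union>i<s. T i) \<le> k \<Longrightarrow> ok T \<Longrightarrow>
      \<exists>C. outputs \<pi> (site_input s T) C \<and> finite C \<and> card ((\<lambda>p. p div s) ` C) \<le> 1.01 * real k \<and>
        (\<Union>i<s. T i) \<subseteq> (\<lambda>p. p div s) ` C"
begin

definition hist :: "(nat \<Rightarrow> nat set) \<Rightarrow> event list" where
  "hist T = history \<pi> (site_input s T)"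

definition found :: "event list \<Rightarrow> nat set" where
  "found h = {l. \<exists>C. coord \<pi> h = Output C \<and> l \<in> (\<lambda>p. p div s) ` C}"

lemma halts:
  assumes "\<And>i. i < s \<Longrightarrow> T i \<subseteq> {..<4 * k}"
  shows "halts_with \<pi> (site_input s T) (hist T)"
proof -
  have "length h \<le> nat \<lfloor>B\<rfloor>" if "run \<pi> (site_input s T) h" for h
    using bits[of T, OF assms that] by (simp add: le_nat_floor)
  then obtain h where "halts_with \<pi> (site_input s T) h"
    using halts_with_exists by blast
  then show ?thesis
    by (simp add: hist_def history_eqI)
qed

lemma length_hist:
  assumes "\<And>i. i < s \<Longrightarrow> T i \<subseteq> {..<4 * k}"
  shows "length (hist T) \<le> B"
  using bits[of T, OF assms] halts[of T, OF assms] by (simp add: halts_with_def)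

lemma ok_found:
  assumes "\<And>i. i < s \<Longrightarrow> T i \<subseteq> {..<4 * k}" "card (\<Union>i<s. T i) \<le> k" "ok T"
  shows "finite (found (hist T))" "card (found (hist T)) \<le> 1.01 * real k" "(\<Union>i<s. T i) \<subseteq> found (hist T)"
proof -
  obtain C where C: "outputs \<pi> (site_input s T) C" "finite C" "card ((\<lambda>p. p div s) ` C) \<le> 1.01 * real k"
    "(\<Union>i<s. T i) \<subseteq> (\<lambda>p. p div s) ` C"
    using ok[of T, OF assms] by blast
  then have "coord \<pi> (hist T) = Output C"
    using halts[of T, OF assms(1)] outputs_history by (simp add: hist_def)
  then have "found (hist T) = (\<lambda>p. p div s) ` C"
    by (auto simp: found_def)
  then show "finite (found (hist T))" "card (found (hist T)) \<le> 1.01 * real k" "(\<Union>i<s. T i) \<subseteq> found (hist T)"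
    using C by auto
qed

text \<open>Sites that are silent on the empty input cannot report their only location.\<close>

lemma singletons_bound:
  assumes "B \<le> s / 10"
  shows "(\<Sum>i<s. \<Sum>e<4 * k. of_bool (ok (\<lambda>l. if l = i then {e} else {}))) \<le> 1.5 * real s * real k"
proof -
  define h where "h = hist (\<lambda>_. {})"
  define used where "used = {i. i < s \<and> view i h \<noteq> []}"
  have h: "halts_with \<pi> (site_input s (\<lambda>_. {})) h"
    unfolding h_def by (rule halts) auto
  have "card used = (\<Sum>i\<in>used. 1)"
    by simp
  also have "\<dots> \<le> (\<Sum>i\<in>used. length (view i h))"
    by (intro sum_mono) (auto simp: used_def Suc_le_eq)
  also have "\<dots> \<le> length h"
    by (rule sum_length_view_le) (simp add: used_def)
  finally have "real (card used) \<le> length h"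
    by simp
  also have "\<dots> \<le> s / 10"
    using length_hist[of "\<lambda>_. {}"] assms by (auto simp: h_def)
  finally have card_used: "card used \<le> s / 10" .
  have row: "(\<Sum>e<4 * k. of_bool (ok (\<lambda>l. if l = i then {e} else {}))) \<le> 1.01 * real k + 4 * k * of_bool (i \<in> used)"
    (is "(\<Sum>e<4 * k. of_bool (ok (?T e))) \<le> _") if "i < s" for i
  proof (cases "i \<in> used")
    case True
    have "(\<Sum>e<4 * k. of_bool (ok (?T e)) :: real) \<le> (\<Sum>e<4 * k. 1)"
      by (intro sum_mono) auto
    then show ?thesis
      using True by simp
  next
    case False
    \<comment> \<open>A site with an empty view has sent nothing, so \<open>h\<close> is compatible
      with each of its inputs; a single output then has to cover every successful
      \<open>e\<close>.\<close>
    have "hist (?T e) = h" for e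
    proof -
      have "site_ok \<pi> l (site_input s (?T e) l) (view l h)" for l
      proof (cases "l = i")
        case True
        then show ?thesis
          using False \<open>i < s\<close> by (simp add: used_def site_ok_def)
      next
        case False
        then have "site_input s (?T e) l = site_input s (\<lambda>_. {}) l"
          by (auto simp: site_input_def fun_eq_iff)
        then show ?thesis
          using h by (simp add: halts_with_def run_iff)
      qed
      then have "halts_with \<pi> (site_input s (?T e)) h"
        using h by (simp add: halts_with_def run_iff)
      then show ?thesis
        by (simp add: hist_def history_eqI)
    qed
    then have okD: "finite (found h) \<and> card (found h) \<le> 1.01 * real k \<and> e \<in> found h" if "e < 4 * k" "ok (?T e)" for e
      using ok_found[of "?T e"] that \<open>i < s\<close> k_pos by (auto split: if_splits)
    have "(\<Sum>e<4 * k. of_bool (ok (?T e)) :: real) = card {e. e < 4 * k \<and> ok (?T e)}"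
      by (simp add: of_bool_def sum.If_cases Int_def)
    also have "\<dots> \<le> 1.01 * real k"
    proof (cases "{e. e < 4 * k \<and> ok (?T e)} = {}")
      case True
      show ?thesis unfolding True by simp
    next
      case False
      then have fin: "finite (found h)" "card (found h) \<le> 1.01 * real k"
        using okD by auto
      then have "card {e. e < 4 * k \<and> ok (?T e)} \<le> card (found h)"
        using okD by (intro card_mono) auto
      then show ?thesis
        using fin by linarith
    qed
    finally show ?thesis
      using False by simp
  qed
  have "(\<Sum>i<s. \<Sum>e<4 * k. of_bool (ok (\<lambda>l. if l = i then {e} else {})))
    \<le> (\<Sum>i<s. 1.01 * real k + 4 * k * of_bool (i \<in> used))"
    using row by (intro sum_mono) auto
  also have "\<dots> = 1.01 * real k * real s + 4 * real k * real (card used)"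
  proof -
    have "{..<s} \<inter> {i. i \<in> used} = used"
      by (auto simp: used_def)
    then have "(\<Sum>i<s. of_bool (i \<in> used) :: real) = card used"
      by (simp add: of_bool_def sum.If_cases)
    then show ?thesis
      by (simp add: sum.distrib sum_distrib_left[symmetric])
  qed
  also have "\<dots> \<le> 1.01 * real k * real s + 4 * real k * (real s / 10)"
    using mult_left_mono[OF card_used, of "4 * real k"] by simp
  also have "\<dots> \<le> 1.5 * real s * real k"
    by (simp add: field_simps)
  finally show ?thesis .
qed

text \<open>With a single site, the transcript has to predict almost all bits of \<open>y\<close>.\<close>

lemma one_site_bound:
  assumes "s = 1" "1000 \<le> k" "B \<le> k / 10000"
  shows "(\<Sum>y\<in>Pow {..<k}. of_bool (ok (\<lambda>_. one_per_block k y))) \<le> 0.9 * (2 :: real) ^ k"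
proof -
  define T where "T y = (\<lambda>_::nat. one_per_block k y)" for y
  define \<tau> where "\<tau> y = hist (T y)" for y
  \<comment> \<open>The guess for \<open>j \<in> y\<close> read off the output: 1 or -1 if exactly
    one location of the block is found, otherwise 0.\<close>
  define \<sigma> where "\<sigma> h j = (of_bool (2 * j + 1 \<in> found h) - of_bool (2 * j \<in> found h) :: real)" for h j
  have valid: "T y i \<subseteq> {..<4 * k}" for y i
    using one_per_block_subset[of k y] by (auto simp: T_def)
  have union: "(\<Union>i<s. T y i) = one_per_block k y" for y
    using \<open>s = 1\<close> by (simp add: T_def lessThan_Suc)
  have chan: "channel e = 0" if "e \<in> set (\<tau> y)" for e y
    using channel_run[OF uses, of _ "\<tau> y" e] halts[of "T y", OF valid] that \<open>s = 1\<close>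
    by (auto simp: halts_with_def \<tau>_def)
  \<comment> \<open>There is no second set here, hence the dummy index \<open>()\<close>. With
    \<open>t = 1/3\<close> the error term becomes \<open>k / 3\<close>, well below the agreement of
    nearly \<open>k\<close> on success.\<close>
  have "1/3 * (\<Sum>z\<in>{()}. \<Sum>y\<in>Pow {..<k}. \<Sum>j<k. \<sigma> (\<tau> y) j * sgn_in j y)
      \<le> (\<Sum>z\<in>{()}. \<Sum>y\<in>Pow {..<k}. code_length (\<tau> y) + (1/3)\<^sup>2 * card {..<k})"
    by (rule code_prediction_bound[where \<tau> = "\<lambda>y _. \<tau> y"])
      (auto simp: \<sigma>_def of_bool_def chan intro!: kraft_code_length[of _ 0])
  then have "(\<Sum>y\<in>Pow {..<k}. \<Sum>j<k. \<sigma> (\<tau> y) j * sgn_in j y) \<le> 3 * (\<Sum>y\<in>Pow {..<k}. code_length (\<tau> y) + k / 9)"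
    by (simp add: power2_eq_square)
  also have "\<dots> \<le> 3 * (\<Sum>y\<in>Pow {..<k}. ln 2 + B * ln 8 + k / 9)"
    unfolding code_length_def \<tau>_def
    using length_hist[of "T _", OF valid] by (intro mult_left_mono sum_mono add_mono mult_right_mono) auto
  also have "\<dots> = 2 ^ k * (3 * ln 2 + 3 * B * ln 8 + k / 3)"
    by (simp add: card_Pow algebra_simps)
  finally have upper: "(\<Sum>y\<in>Pow {..<k}. \<Sum>j<k. \<sigma> (\<tau> y) j * sgn_in j y) \<le> 2 ^ k * (3 * ln 2 + 3 * B * ln 8 + k / 3)" .
  \<comment> \<open>On success at most \<open>0.01 * k\<close> blocks give no prediction and all
    others a correct one, so the agreement is at least \<open>0.99 * k\<close>; in general it is at
    least \<open>- k\<close>.\<close>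
  have lower: "1.99 * k * of_bool (ok (T y)) - k \<le> (\<Sum>j<k. \<sigma> (\<tau> y) j * sgn_in j y)" for y
  proof (cases "ok (T y)")
    case True
    define F where "F = found (\<tau> y)"
    have F: "finite F" "card F \<le> 1.01 * real k" "one_per_block k y \<subseteq> F"
      using ok_found[of "T y", OF valid _ True] unfolding union card_one_per_block F_def \<tau>_def by auto
    have "card {j. j < k \<and> 2 * j + of_bool (j \<notin> y) \<in> F} + k \<le> card F"
      using F by (intro card_double_blocks)
    then have small: "card {j. j < k \<and> 2 * j + of_bool (j \<notin> y) \<in> F} \<le> 0.01 * real k"
      using F(2) by (simp add: field_simps)
    have \<sigma>_eq: "\<sigma> (\<tau> y) j * sgn_in j y = 1 - of_bool (2 * j + of_bool (j \<notin> y) \<in> F)" if "j < k" for j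
    proof -
      have "2 * j + of_bool (j \<in> y) \<in> F"
        using F(3) that by (auto simp: one_per_block_def)
      then show ?thesis
        by (cases "j \<in> y") (auto simp: \<sigma>_def F_def[symmetric])
    qed
    have "(\<Sum>j<k. \<sigma> (\<tau> y) j * sgn_in j y) = (\<Sum>j<k. 1 - of_bool (2 * j + of_bool (j \<notin> y) \<in> F))"
      by (rule sum.cong[OF refl], rule \<sigma>_eq) simp
    also have "\<dots> = real k - (\<Sum>j<k. of_bool (2 * j + of_bool (j \<notin> y) \<in> F))"
      unfolding sum_subtractf by simp
    also have "(\<Sum>j<k. of_bool (2 * j + of_bool (j \<notin> y) \<in> F)) = real (card {j. j < k \<and> 2 * j + of_bool (j \<notin> y) \<in> F})"
      by (simp add: of_bool_def[of "_ \<in> F"] sum.If_cases Int_def)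
    finally show ?thesis
      using small True by simp
  next
    case False
    have "(\<Sum>j<k. - 1) \<le> (\<Sum>j<k. \<sigma> (\<tau> y) j * sgn_in j y)"
      by (intro sum_mono) (auto simp: \<sigma>_def)
    then show ?thesis
      using False by simp
  qed
  have "1.99 * k * (\<Sum>y\<in>Pow {..<k}. of_bool (ok (T y))) - 2 ^ k * k
      = (\<Sum>y\<in>Pow {..<k}. 1.99 * k * of_bool (ok (T y)) - k)"
    unfolding sum_subtractf sum_distrib_left[symmetric] by (simp add: card_Pow)
  also have "\<dots> \<le> 2 ^ k * (3 * ln 2 + 3 * B * ln 8 + k / 3)"
    using upper lower by (meson order_trans sum_mono)
  finally have "1.99 * k * (\<Sum>y\<in>Pow {..<k}. of_bool (ok (T y))) \<le> 2 ^ k * (3 * ln 2 + 3 * B * ln 8 + k / 3 + k)"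
    by (simp add: algebra_simps)
  also have "\<dots> \<le> 2 ^ k * (1.99 * k * 0.9)"
  proof -
    have ln8: "ln 8 = 3 * ln (2::real)"
      using ln_realpow[of 2 3] by simp
    have ln2: "ln (2::real) \<le> 0.7"
      using ln2_le_25_over_36 by simp
    have "B * ln 8 \<le> (k / 10000) * ln 8"
      using assms(3) by (intro mult_right_mono) auto
    also have "\<dots> \<le> (k / 10000) * 2.1"
      using ln8 ln2 by (intro mult_left_mono) auto
    \<comment> \<open>The left side is below \<open>1.34 * k\<close>, the right side is
      \<open>1.791 * k\<close>.\<close>
    finally have "3 * ln 2 + 3 * (B * ln 8) + k / 3 + k \<le> 1.99 * k * 0.9"
      using ln2 \<open>1000 \<le> k\<close> by simp
    then have "3 * ln 2 + 3 * B * ln 8 + k / 3 + k \<le> 1.99 * k * 0.9"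
      by (simp only: mult.assoc)
    then show ?thesis
      by (intro mult_left_mono) auto
  qed
  finally have "1.99 * k * (\<Sum>y\<in>Pow {..<k}. of_bool (ok (T y))) \<le> 1.99 * k * (0.9 * 2 ^ k)"
    by (simp add: algebra_simps)
  then have "(\<Sum>y\<in>Pow {..<k}. of_bool (ok (T y))) \<le> 0.9 * (2::real) ^ k"
    using k_pos by (subst (asm) mult_le_cancel_left_pos) auto
  then show ?thesis
    by (simp add: T_def)
qed


section \<open>The hard inputs for many sites\<close>

definition evens :: "nat set \<Rightarrow> nat set" where
  "evens x = (\<lambda>j. 2 * j) ` (x \<inter> {..<k - 1})"

text \<open>With \<open>y\<close> removed from \<open>u l\<close>, the even locations of the other
  sites are already among those of site 0 and add nothing to the union.\<close>

definition hard_input :: "(nat \<Rightarrow> nat set) \<Rightarrow> nat set \<Rightarrow> nat \<Rightarrow> nat set" where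
  "hard_input u y l = (if l = 0 then one_per_block (k - 1) y else evens (u l - y))"

text \<open>Here \<open>x\<close> may meet \<open>y\<close>, which gives site \<open>i\<close> an
  additional location. The other inputs depend on \<open>y\<close> but not on \<open>x\<close>, so
  site \<open>i\<close> and the rest form a two-party game.\<close>

definition pair_input :: "nat \<Rightarrow> (nat \<Rightarrow> nat set) \<Rightarrow> nat set \<Rightarrow> nat set \<Rightarrow> nat \<Rightarrow> nat set" where
  "pair_input i u x y = (hard_input u y)(i := evens x)"

lemma hard_input_subset: "hard_input u y l \<subseteq> {..<4 * k}"
  using one_per_block_subset[of "k - 1" y] by (auto simp: hard_input_def evens_def)

lemma pair_input_subset: "pair_input i u x y l \<subseteq> {..<4 * k}"
  using hard_input_subset[of u y l] by (auto simp: pair_input_def evens_def)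

lemma evens_subset: "x \<inter> y = {} \<Longrightarrow> evens x \<subseteq> one_per_block (k - 1) y"
  by (force simp: evens_def one_per_block_def)

lemma hard_input_subset_block: "hard_input u y l \<subseteq> one_per_block (k - 1) y"
  using evens_subset[of "u l - y" y] by (auto simp: hard_input_def)

text \<open>Rectangle property of this game, with the view of site \<open>i\<close> as transcript:
  given \<open>y'\<close>, the view even determines the whole history.\<close>

lemma pair_input_rectangle:
  assumes "view i (hist (pair_input i u x y)) = view i (hist (pair_input i u x' y'))"
  shows "hist (pair_input i u x y') = hist (pair_input i u x' y')"
proof -
  have "halts_with \<pi> (site_input s (pair_input i u x y')) (hist (pair_input i u x' y'))"
  proof (rule halts_with_mix[OF _ _ assms])
    show "halts_with \<pi> (site_input s (pair_input i u x y)) (hist (pair_input i u x y))"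
      "halts_with \<pi> (site_input s (pair_input i u x' y')) (hist (pair_input i u x' y'))"
      by (intro halts pair_input_subset)+
  qed (auto simp: site_input_def pair_input_def fun_eq_iff)
  then show ?thesis
    unfolding hist_def[of "pair_input i u x y'"] by (rule history_eqI)
qed

text \<open>Success on \<open>x\<close> leaves room for at most \<open>0.01 * k + 1\<close> blocks
  \<open>j \<in> y\<close> with \<open>2 * j\<close> found, while success on
  \<open>insert j x\<close> forces \<open>2 * j\<close> to be found. Both are frequent only if the
  view of site \<open>i\<close> separates the two inputs, which by
  \<open>rectangle_partition_bound\<close> costs bits. Constant success would give
  \<open>0.5 * m\<close> in place of \<open>0.45 * m\<close>.\<close>

lemma hidden_location_bound:
  assumes i: "0 < i" "i < s" and k: "2 \<le> k"
  defines "m \<equiv> k - 1"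
  shows "frame_sum {..<m} (\<lambda>x y. \<Sum>j\<in>y. of_bool (ok (pair_input i u x y)) + of_bool (ok (pair_input i u (insert j x) y)))
    \<le> 4 ^ m * (0.45 * real m + 0.01 * real k + 1 + 20 * ln 2)
      + 20 * ln 8 * frame_sum {..<m} (\<lambda>x y. length (view i (hist (pair_input i u x y))))"
proof -
  define T where "T = pair_input i u"
  define \<tau> where "\<tau> x y = view i (hist (T x y))" for x y
  define g where "g x y j = (of_bool (2 * j \<notin> found (hist (T x y))) :: real)" for x y and j :: nat
  have valid: "T x y l \<subseteq> {..<4 * k}" for x y l
    unfolding T_def by (rule pair_input_subset)
  have T0: "T x y 0 = one_per_block m y" and Ti: "T x y i = evens x" for x y
    using i by (simp_all add: T_def pair_input_def hard_input_def m_def)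
  have T_sub: "T x y l \<subseteq> evens x \<union> one_per_block m y" for x y l
    using hard_input_subset_block[of u y l] by (cases "l = i") (auto simp: T_def pair_input_def m_def)
  have union_sub: "(\<Union>l<s. T x y l) \<subseteq> evens x \<union> one_per_block m y" for x y
    using T_sub by (intro UN_least)
  \<comment> \<open>For \<open>t = 1/10\<close> the error term is
    \<open>20 * m / 100 = m / 5\<close>; with the mean \<open>m / 4\<close> of \<open>card y\<close>
    it makes up \<open>0.45 * m\<close>.\<close>
  have "1/10 * frame_sum {..<m} (\<lambda>x y. \<Sum>j\<in>y. g x y j - g (insert j x) y j)
      \<le> 2 * frame_sum {..<m} (\<lambda>x y. code_length (\<tau> x y) + (1/10)\<^sup>2 * card {..<m})"
  proof (rule rectangle_partition_bound[where \<tau> = \<tau> and lam = code_length and g = g])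
    show "\<tau> x y' = \<tau> x y" if "\<tau> x y = \<tau> x' y'" for x y x' y'
      using pair_input_rectangle[of i u x y x' y'] that by (simp add: \<tau>_def T_def)
    show "g x y j = g x' y j" if "\<tau> x y = \<tau> x' y" for x x' y j
      using pair_input_rectangle[of i u x y x' y] that by (simp add: g_def \<tau>_def T_def)
    show "(\<Sum>v\<in>R. exp (- code_length v)) \<le> 1" if "finite R" "R \<subseteq> range (\<lambda>(x, y). \<tau> x y)" for R
      using that by (intro kraft_code_length[of R i]) (auto simp: \<tau>_def dest!: channel_view)
  qed (auto simp: g_def)
  then have gap: "frame_sum {..<m} (\<lambda>x y. \<Sum>j\<in>y. g x y j - g (insert j x) y j)
      \<le> 20 * frame_sum {..<m} (\<lambda>x y. ln 8 * real (length (\<tau> x y)) + (ln 2 + m / 100) * 1)"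
    by (simp add: code_length_def power2_eq_square add_ac mult_ac)
  have "frame_sum {..<m} (\<lambda>x y. \<Sum>j\<in>y. of_bool (ok (T x y)) + of_bool (ok (T (insert j x) y)))
    \<le> frame_sum {..<m} (\<lambda>x y. (real (card y) + (0.01 * real k + 1) * 1) + (\<Sum>j\<in>y. g x y j - g (insert j x) y j))"
  proof (rule frame_sum_mono)
    fix x y assume xy: "x \<subseteq> {..<m}" "y \<subseteq> {..<m}" "x \<inter> y = {}"
    have finy: "finite y"
      using xy by (auto intro: finite_subset)
    have "(\<Sum>j\<in>y. of_bool (ok (T x y))) \<le> 0.01 * real k + 1 + (\<Sum>j\<in>y. g x y j)"
    proof (cases "ok (T x y)")
      case True
      define F where "F = found (hist (T x y))"
      have "(\<Union>l<s. T x y l) \<subseteq> one_per_block m y"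
        using union_sub[of x y] evens_subset[OF xy(3)] by (simp add: m_def subset_Un_eq Un_absorb1)
      then have "card (\<Union>l<s. T x y l) \<le> card (one_per_block m y)"
        by (intro card_mono) (simp_all add: one_per_block_def)
      then have "card (\<Union>l<s. T x y l) \<le> k"
        by (simp add: card_one_per_block m_def)
      note F' = ok_found[of "T x y", OF valid this True, folded F_def]
      have "T x y 0 \<subseteq> F"
        using F'(3) s_pos by (meson UN_upper lessThan_iff less_le_trans order_trans zero_less_one)
      then have F: "finite F" "card F \<le> 1.01 * real k" "one_per_block m y \<subseteq> F"
        using F' by (simp_all only: T0)
      have "card (y \<inter> {j. 2 * j \<in> F}) \<le> card {j. j < m \<and> 2 * j + of_bool (j \<notin> y) \<in> F}"
        using xy by (intro card_mono) auto
      also have "\<dots> + m \<le> card F"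
        using F by (intro card_double_blocks)
      finally have "real (card (y \<inter> {j. 2 * j \<in> F})) + real m \<le> 1.01 * real k"
        using F(2) by linarith
      \<comment> \<open>Using \<open>k - 1\<close> blocks costs the summand 1 here and leaves room
        for the additional location below.\<close>
      moreover have "real m = real k - 1"
        using k by (simp add: m_def)
      moreover have "real (card y) = card (y \<inter> {j. 2 * j \<in> F}) + (\<Sum>j\<in>y. g x y j)"
      proof -
        have "(\<Sum>j\<in>y. 1 :: real) = (\<Sum>j\<in>y. of_bool (2 * j \<in> F) + g x y j)"
          by (intro sum.cong) (auto simp: g_def F_def)
        then show ?thesis
          using finy by (simp add: sum.distrib sum_of_bool_eq)
      qed
      ultimately show ?thesis
        using True by (simp add: field_simps)
    next
      case False
      have "0 \<le> (\<Sum>j\<in>y. g x y j)"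
        by (intro sum_nonneg) (simp add: g_def)
      then show ?thesis
        using False by simp
    qed
    moreover have "(\<Sum>j\<in>y. of_bool (ok (T (insert j x) y))) \<le> (\<Sum>j\<in>y. 1 - g (insert j x) y j)"
    proof (rule sum_mono)
      fix j assume j: "j \<in> y"
      show "of_bool (ok (T (insert j x) y)) \<le> 1 - g (insert j x) y j"
      proof (cases "ok (T (insert j x) y)")
        case True
        have "evens (insert j x) \<subseteq> insert (2 * j) (one_per_block m y)"
          using evens_subset[OF xy(3)] by (auto simp: evens_def m_def)
        then have "evens (insert j x) \<union> one_per_block m y \<subseteq> insert (2 * j) (one_per_block m y)"
          by blast
        with union_sub[of "insert j x" y]
        have "(\<Union>l<s. T (insert j x) y l) \<subseteq> insert (2 * j) (one_per_block m y)"
          by (rule order_trans)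
        then have "card (\<Union>l<s. T (insert j x) y l) \<le> card (insert (2 * j) (one_per_block m y))"
          by (intro card_mono) (simp_all add: one_per_block_def)
        also have "\<dots> \<le> k"
          using card_insert_le_m1[of "k" "one_per_block m y" "2 * j"] k by (simp add: card_one_per_block m_def)
        finally have "(\<Union>l<s. T (insert j x) y l) \<subseteq> found (hist (T (insert j x) y))"
          using ok_found(3)[of "T (insert j x) y", OF valid _ True] by simp
        then have "T (insert j x) y i \<subseteq> found (hist (T (insert j x) y))"
          using i(2) by (meson UN_upper lessThan_iff order_trans)
        moreover have "2 * j \<in> evens (insert j x)"
          using j xy by (auto simp: evens_def m_def)
        ultimately have "2 * j \<in> found (hist (T (insert j x) y))"
          unfolding Ti by (rule subsetD)
        then show ?thesis
          by (simp add: g_def)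
      qed (simp add: g_def)
    qed
    ultimately show "(\<Sum>j\<in>y. of_bool (ok (T x y)) + of_bool (ok (T (insert j x) y)))
      \<le> (real (card y) + (0.01 * real k + 1) * 1) + (\<Sum>j\<in>y. g x y j - g (insert j x) y j)"
      unfolding sum.distrib sum_subtractf by simp
  qed
  also have "\<dots> = 4 ^ m * (real m / 4 + 0.01 * real k + 1)
      + frame_sum {..<m} (\<lambda>x y. \<Sum>j\<in>y. g x y j - g (insert j x) y j)"
    unfolding frame_sum_add frame_sum_mult by (simp add: frame_sum_card frame_sum_1 algebra_simps)
  also have "\<dots> \<le> 4 ^ m * (real m / 4 + 0.01 * real k + 1)
      + 20 * frame_sum {..<m} (\<lambda>x y. ln 8 * real (length (\<tau> x y)) + (ln 2 + m / 100) * 1)"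
    using gap by simp
  also have "\<dots> = 4 ^ m * (0.45 * real m + 0.01 * real k + 1 + 20 * ln 2)
      + 20 * ln 8 * frame_sum {..<m} (\<lambda>x y. length (\<tau> x y))"
    unfolding frame_sum_add frame_sum_mult by (simp add: frame_sum_1 algebra_simps)
  finally show ?thesis
    by (simp add: T_def \<tau>_def)
qed

text \<open>Resampling turns the random \<open>x\<close> of site \<open>i\<close> into the set
  \<open>u i - y\<close> of \<open>hard_input\<close>, whose distribution is the same for every
  \<open>i\<close>. The views of all sites then belong to one history of at most \<open>B\<close>
  bits, so the average site sees at most \<open>B / (s - 1)\<close> of them.\<close>

lemma many_sites_bound:
  assumes s2: "2 \<le> s" and k: "1000 \<le> k" and B: "B \<le> s * k / 10000"
  defines "m \<equiv> k - 1" and "I \<equiv> {1..<s}"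
  defines "w \<equiv> \<lambda>u. \<Prod>l\<in>I. (1/2 :: real) ^ card (u l)" and "Us \<equiv> PiE I (\<lambda>_. Pow {..<m})"
  shows "(\<Sum>i\<in>I. \<Sum>u\<in>Us. w u * frame_sum {..<m} (\<lambda>x y. \<Sum>j\<in>y.
      of_bool (ok (pair_input i u x y)) + of_bool (ok (pair_input i u (insert j x) y))))
    \<le> (real s - 1) * (\<Sum>u\<in>Us. w u) * (4 ^ m * (0.49 * real m))"
proof -
  define Z where "Z = (\<Sum>u\<in>Us. w u)"
  define c where "c = (\<Sum>v\<in>Pow {..<m}. (1/2 :: real) ^ card v)"
  define len where "len i y u = real (length (view i (hist (hard_input u y))))" for i y u
  have w_nonneg: "0 \<le> w u" for u
    by (simp add: w_def prod_nonneg)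
  have finI: "finite I"
    by (simp add: I_def)
  have total: "2 ^ m * (\<Sum>y\<in>Pow {..<m}. (1/3) ^ card y * c) = 4 ^ m"
    using frame_sum_resample[of "{..<m}" "\<lambda>x y. 1"] by (simp add: frame_sum_1 c_def)
  have site_len: "(\<Sum>u\<in>Us. w u * frame_sum {..<m} (\<lambda>x y. length (view i (hist (pair_input i u x y)))))
      = 2 ^ m * (\<Sum>y\<in>Pow {..<m}. (1/3) ^ card y * (c * (\<Sum>u\<in>Us. w u * len i y u)))" if "i \<in> I" for i
  proof -
    \<comment> \<open>By \<open>frame_sum_resample\<close>, \<open>x\<close> has the form
      \<open>v - y\<close>, and storing \<open>v\<close> in coordinate \<open>i\<close> gives a hard
      input again.\<close>
    have "pair_input i u (v - y) y = hard_input (u(i := v)) y" for u v y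
      using that by (auto simp: pair_input_def hard_input_def I_def fun_eq_iff)
    then have "(\<Sum>u\<in>Us. w u * frame_sum {..<m} (\<lambda>x y. length (view i (hist (pair_input i u x y)))))
      = (\<Sum>u\<in>Us. w u * (2 ^ m * (\<Sum>y\<in>Pow {..<m}. (1/3) ^ card y * (\<Sum>v\<in>Pow {..<m}. (1/2) ^ card v * len i y (u(i := v))))))"
      by (simp add: frame_sum_resample len_def)
    also have "\<dots> = 2 ^ m * (\<Sum>u\<in>Us. \<Sum>y\<in>Pow {..<m}. (1/3) ^ card y * (w u * (\<Sum>v\<in>Pow {..<m}. (1/2) ^ card v * len i y (u(i := v)))))"
      unfolding sum_distrib_left[of _ _ "Us"] sum_distrib_left[of _ _ "Pow {..<m}"] by (simp add: mult_ac)
    also have "(\<Sum>u\<in>Us. \<Sum>y\<in>Pow {..<m}. (1/3) ^ card y * (w u * (\<Sum>v\<in>Pow {..<m}. (1/2) ^ card v * len i y (u(i := v)))))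
      = (\<Sum>y\<in>Pow {..<m}. (1/3) ^ card y * (\<Sum>u\<in>Us. w u * (\<Sum>v\<in>Pow {..<m}. (1/2) ^ card v * len i y (u(i := v)))))"
      by (subst sum.swap) (simp only: sum_distrib_left[of _ _ "Us"])
    also have "\<dots> = (\<Sum>y\<in>Pow {..<m}. (1/3) ^ card y * (c * (\<Sum>u\<in>Us. w u * len i y u)))"
    proof (rule sum.cong[OF refl])
      fix y
      show "(1/3) ^ card y * (\<Sum>u\<in>Us. w u * (\<Sum>v\<in>Pow {..<m}. (1/2) ^ card v * len i y (u(i := v))))
        = (1/3) ^ card y * (c * (\<Sum>u\<in>Us. w u * len i y u))"
        unfolding w_def Us_def c_def
        by (simp only: sum_PiE_resample[OF finI that, where w = "\<lambda>v. (1/2) ^ card v" and F = "len i y"])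
    qed
    finally show ?thesis .
  qed
  have len_le: "(\<Sum>i\<in>I. len i y u) \<le> B" for y u
  proof -
    have "(\<Sum>i\<in>I. len i y u) = real (\<Sum>i\<in>I. length (view i (hist (hard_input u y))))"
      by (simp add: len_def)
    also have "\<dots> \<le> length (hist (hard_input u y))"
      using sum_length_view_le[OF finI] by (simp only: of_nat_le_iff)
    also have "\<dots> \<le> B"
      by (intro length_hist hard_input_subset)
    finally show ?thesis .
  qed
  have "(\<Sum>i\<in>I. \<Sum>u\<in>Us. w u * frame_sum {..<m} (\<lambda>x y. length (view i (hist (pair_input i u x y)))))
      = (\<Sum>i\<in>I. 2 ^ m * (\<Sum>y\<in>Pow {..<m}. (1/3) ^ card y * (c * (\<Sum>u\<in>Us. w u * len i y u))))"
    by (intro sum.cong refl site_len)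
  \<comment> \<open>The sum over the sites moves inside, where all views come from the same
    history.\<close>
  also have "\<dots> = 2 ^ m * (\<Sum>y\<in>Pow {..<m}. (1/3) ^ card y * (c * (\<Sum>u\<in>Us. w u * (\<Sum>i\<in>I. len i y u))))"
    by (simp only: sum_distrib_left sum.swap[of _ _ I])
  also have "\<dots> \<le> 2 ^ m * (\<Sum>y\<in>Pow {..<m}. (1/3) ^ card y * (c * (\<Sum>u\<in>Us. w u * B)))"
    using len_le w_nonneg by (intro mult_left_mono sum_mono) (auto simp: c_def intro!: sum_nonneg)
  also have "\<dots> = 2 ^ m * (\<Sum>y\<in>Pow {..<m}. (1/3) ^ card y * c) * (Z * B)"
    unfolding Z_def by (simp only: sum_distrib_right[symmetric] mult.assoc)
  also have "\<dots> = Z * 4 ^ m * B"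
    unfolding total by simp
  finally have bits_total: "(\<Sum>i\<in>I. \<Sum>u\<in>Us. w u * frame_sum {..<m} (\<lambda>x y. length (view i (hist (pair_input i u x y)))))
      \<le> Z * 4 ^ m * B" .
  define a where "a = 4 ^ m * (0.45 * real m + 0.01 * real k + 1 + 20 * ln 2)"
  have "(\<Sum>i\<in>I. \<Sum>u\<in>Us. w u * frame_sum {..<m} (\<lambda>x y. \<Sum>j\<in>y.
      of_bool (ok (pair_input i u x y)) + of_bool (ok (pair_input i u (insert j x) y))))
    \<le> (\<Sum>i\<in>I. \<Sum>u\<in>Us. w u * (a + 20 * ln 8 * frame_sum {..<m} (\<lambda>x y. length (view i (hist (pair_input i u x y))))))"
    unfolding a_def m_def using k w_nonneg by (intro sum_mono mult_left_mono hidden_location_bound) (auto simp: I_def)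
  also have "\<dots> = card I * (Z * a)
      + 20 * ln 8 * (\<Sum>i\<in>I. \<Sum>u\<in>Us. w u * frame_sum {..<m} (\<lambda>x y. length (view i (hist (pair_input i u x y)))))"
  proof -
    have "(\<Sum>u\<in>Us. w u * (a + 20 * ln 8 * f u)) = Z * a + 20 * ln 8 * (\<Sum>u\<in>Us. w u * f u)" for f
      by (simp add: distrib_left sum.distrib Z_def sum_distrib_right sum_distrib_left mult_ac)
    then show ?thesis
      by (simp add: sum.distrib sum_distrib_left[symmetric])
  qed
  also have "\<dots> \<le> card I * (Z * a) + 20 * ln 8 * (Z * 4 ^ m * B)"
    using bits_total by (intro add_left_mono mult_left_mono) auto
  also have "\<dots> = Z * 4 ^ m * ((real s - 1) * (0.45 * real m + 0.01 * real k + 1 + 20 * ln 2) + 20 * ln 8 * B)"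
    using s2 by (simp add: a_def I_def algebra_simps of_nat_diff)
  also have "\<dots> \<le> Z * 4 ^ m * ((real s - 1) * (0.49 * real m))"
  proof (intro mult_left_mono)
    have s1: "1 \<le> real s - 1" and k': "1000 \<le> real k" and m: "real m = real k - 1"
      using s2 k by (auto simp: m_def of_nat_diff)
    have ln8: "ln 8 = 3 * ln (2::real)"
      using ln_realpow[of 2 3] by simp
    have ln2: "ln (2::real) \<le> 0.7"
      using ln2_le_25_over_36 by simp
    \<comment> \<open>As \<open>s \<ge> 2\<close>, \<open>s\<close> is at most
      \<open>2 * (s - 1)\<close>; so \<open>B\<close> can be shared among the sites other than
      0.\<close>
    have "real s * real k \<le> (2 * (real s - 1)) * real k"
      using s1 by (intro mult_right_mono) auto
    then have "B \<le> (real s - 1) * (real k / 5000)"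
      using B by (simp add: field_simps)
    then have "20 * ln 8 * B \<le> 20 * ln 8 * ((real s - 1) * (real k / 5000))"
      by (intro mult_left_mono) auto
    also have "\<dots> \<le> 42 * ((real s - 1) * (real k / 5000))"
      using ln8 ln2 s1 by (intro mult_right_mono) auto
    also have "\<dots> = (real s - 1) * (0.0084 * real k)"
      by simp
    finally have "(real s - 1) * b + 20 * ln 8 * B \<le> (real s - 1) * (b + 0.0084 * real k)" for b
      unfolding distrib_left by (rule add_left_mono)
    \<comment> \<open>The slack \<open>0.04 * m\<close> exceeds \<open>0.0184 * k + 15\<close> since
      \<open>k \<ge> 1000\<close>.\<close>
    moreover have "0.45 * real m + 0.01 * real k + 1 + 20 * ln 2 + 0.0084 * real k \<le> 0.49 * real m"
      using ln2 k' by (simp add: m field_simps)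
    then have "(real s - 1) * (0.45 * real m + 0.01 * real k + 1 + 20 * ln 2 + 0.0084 * real k)
        \<le> (real s - 1) * (0.49 * real m)"
      using s1 by (intro mult_left_mono) auto
    ultimately show "(real s - 1) * (0.45 * real m + 0.01 * real k + 1 + 20 * ln 2) + 20 * ln 8 * B
      \<le> (real s - 1) * (0.49 * real m)"
      by (rule order_trans)
    show "0 \<le> Z * 4 ^ m"
      using w_nonneg by (simp add: Z_def sum_nonneg)
  qed
  finally show ?thesis
    by (simp add: Z_def mult_ac)
qed

end

section \<open>The lower bound\<close>

lemma lower_mean_frame_sum:
  assumes "\<And>x y. x \<subseteq> E \<Longrightarrow> y \<subseteq> E \<Longrightarrow> x \<inter> y = {} \<Longrightarrow> lower_mean R q (\<lambda>z. f z x y) (w x y)"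
  shows "lower_mean R q (\<lambda>z. frame_sum E (f z)) (frame_sum E w)"
  unfolding frame_sum_def by (intro lower_mean_sum assms) auto

theorem theorem4p2:
  "\<exists>\<delta>>0. \<exists>K::nat. \<forall>c\<in>{1..1.01::real}. \<forall>obj\<in>{kmedian_cost, kmeans_cost}. \<forall>weighted.
     \<forall>s\<ge>1. \<forall>k\<ge>1. \<exists>(S :: nat set) d.
       Metric_space S d \<and> finite S \<and> S \<noteq> {} \<and> card S \<le> (s + k) ^ K \<and>
       (\<forall>R. randomized_protocol s R \<longrightarrow>
            computes_bicriteria 0.99 weighted (obj d) S s k (7.1 - 6 * c) c R \<longrightarrow>
            communication weighted S s R \<ge> ereal (\<delta> * real s * real k))"
proof -
  have bound: "communication weighted {..<4 * k * s} s R \<ge> ereal (1 / 10000 * real s * real k)"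
    if c: "c \<in> {1..1.01::real}" and obj: "obj \<in> {kmedian_cost, kmeans_cost}" and s: "1 \<le> s" and k: "1 \<le> k"
      and R: "randomized_protocol s R"
      and comp: "computes_bicriteria 0.99 weighted (obj (loc_dist s k)) {..<4 * k * s} s k (7.1 - 6 * c) c R"
    for c obj weighted and s k :: nat and R
  proof (rule ccontr)
    define B where "B = 1 / 10000 * real s * real k"
    assume "\<not> ereal (1 / 10000 * real s * real k) \<le> communication weighted {..<4 * k * s} s R"
    then have less: "communication weighted {..<4 * k * s} s R < ereal B"
      by (simp add: B_def not_le)
    define ok where "ok \<pi> T \<longleftrightarrow> (\<exists>C. outputs \<pi> (site_input s T) C \<and>
      bicriteria_solution (obj (loc_dist s k)) {..<4 * k * s} k (7.1 - 6 * c) c (whole_input s (site_input s T)) C)" for \<pi> T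
    have prob: "prob_space R"
      using R by (simp add: randomized_protocol_def)
    have protocol: "union_protocol s k \<pi> B (ok \<pi>)" if "\<pi> \<in> space R" for \<pi>
    proof
      show "uses_sites s \<pi>"
        using R that by (simp add: randomized_protocol_def)
    next
      fix T h assume T: "\<And>i. i < s \<Longrightarrow> T i \<subseteq> {..<4 * k}" and run: "run \<pi> (site_input s T) h"
      have "distributed_input weighted {..<4 * k * s} s (site_input s T)"
        using s T by (rule distributed_site_input)
      then have "ereal (real (length h)) \<le> communication weighted {..<4 * k * s} s R"
        unfolding communication_def using run that by (intro Sup_upper) blast
      then have "ereal (real (length h)) < ereal B"
        using less by (rule le_less_trans)
      then show "length h \<le> B"
        by simp
    next
      fix T assume T: "\<And>i. i < s \<Longrightarrow> T i \<subseteq> {..<4 * k}" and card: "card (\<Union>i<s. T i) \<le> k" and "ok \<pi> T"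
      then obtain C where C: "outputs \<pi> (site_input s T) C"
        "bicriteria_solution (obj (loc_dist s k)) {..<4 * k * s} k (7.1 - 6 * c) c (whole_input s (site_input s T)) C"
        by (auto simp: ok_def)
      moreover have "finite C"
        using C(2) by (simp add: bicriteria_solution_def center_sets_def)
      ultimately show "\<exists>C. outputs \<pi> (site_input s T) C \<and> finite C \<and> card ((\<lambda>p. p div s) ` C) \<le> 1.01 * real k \<and>
        (\<Union>i<s. T i) \<subseteq> (\<lambda>p. p div s) ` C"
        using bicriteria_solution_covers[OF s k c obj T card C(2)] by blast
    qed (fact s k)+
    have mean: "lower_mean R 0.99 (\<lambda>\<pi>. of_bool (ok \<pi> T)) 1" if T: "\<And>i. i < s \<Longrightarrow> T i \<subseteq> {..<4 * k}" for T
    proof (rule lower_mean_of_bool[OF prob])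
      have "distributed_input weighted {..<4 * k * s} s (site_input s T)"
        using s T by (rule distributed_site_input)
      then show "0.99 \<le> measure R {\<pi> \<in> space R. ok \<pi> T}"
        using comp unfolding computes_bicriteria_def ok_def by blast
    qed simp
    \<comment> \<open>For small \<open>k\<close> it suffices that most sites stay silent; a single
      site leaves the prediction of \<open>y\<close>; otherwise the additional location is hidden
      among the sites.\<close>
    consider "k < 1000" | "1000 \<le> k" "s = 1" | "1000 \<le> k" "2 \<le> s"
      using s by linarith
    then show False
    proof cases
      case 1
      have "lower_mean R 0.99 (\<lambda>\<pi>. \<Sum>i<s. \<Sum>e<4 * k. of_bool (ok \<pi> (\<lambda>l. if l = i then {e} else {})))
        (\<Sum>i<s. \<Sum>e<4 * k. 1)"
        by (intro lower_mean_sum mean) auto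
      then have "0.99 * (\<Sum>i<s. \<Sum>e<4 * k. 1) \<le> 1.5 * real s * real k"
      proof (rule lower_mean_le[OF prob])
        fix \<pi> assume "\<pi> \<in> space R"
        then interpret union_protocol s k \<pi> B "ok \<pi>"
          by (rule protocol)
        have "real s * real k \<le> real s * 1000"
          using 1 by (intro mult_left_mono) auto
        then have "B \<le> s / 10"
          by (simp add: B_def mult.commute)
        then show "(\<Sum>i<s. \<Sum>e<4 * k. of_bool (ok \<pi> (\<lambda>l. if l = i then {e} else {}))) \<le> 1.5 * real s * real k"
          by (rule singletons_bound)
      qed
      moreover have "0 < real s * real k"
        using s k by simp
      ultimately show False
        by (simp add: mult.commute)
    next
      case 2
      have "lower_mean R 0.99 (\<lambda>\<pi>. \<Sum>y\<in>Pow {..<k}. of_bool (ok \<pi> (\<lambda>_. one_per_block k y))) (\<Sum>y\<in>Pow {..<k}. 1)"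
        using one_per_block_subset[of k] by (intro lower_mean_sum mean) force
      then have "0.99 * (\<Sum>y\<in>Pow {..<k}. 1) \<le> 0.9 * (2::real) ^ k"
      proof (rule lower_mean_le[OF prob])
        fix \<pi> assume "\<pi> \<in> space R"
        then interpret union_protocol s k \<pi> B "ok \<pi>"
          by (rule protocol)
        show "(\<Sum>y\<in>Pow {..<k}. of_bool (ok \<pi> (\<lambda>_. one_per_block k y))) \<le> 0.9 * (2::real) ^ k"
          using 2 by (intro one_site_bound) (auto simp: B_def)
      qed
      then show False
        by (simp add: card_Pow)
    next
      case 3
      define m where "m = k - 1"
      define I where "I = {1..<s}"
      define w where "w u = (\<Prod>l\<in>I. (1/2 :: real) ^ card (u l))" for u :: "nat \<Rightarrow> nat set"
      define Us where "Us = PiE I (\<lambda>_. Pow {..<m})"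
      \<comment> \<open>These inputs depend on \<open>k\<close> but not on the protocol, so the
        coins can be averaged out for each input separately.\<close>
      define inp where "inp = union_protocol.pair_input k"
      have inp_sub: "inp i u x y l \<subseteq> {..<4 * k}" for i u x y l
      proof -
        obtain \<pi> where "\<pi> \<in> space R"
          using prob_space.not_empty[OF prob] by blast
        then interpret union_protocol s k \<pi> B "ok \<pi>"
          by (rule protocol)
        show ?thesis
          unfolding inp_def by (rule pair_input_subset)
      qed
      have "lower_mean R 0.99 (\<lambda>\<pi>. \<Sum>i\<in>I. \<Sum>u\<in>Us. w u * frame_sum {..<m} (\<lambda>x y. \<Sum>j\<in>y.
          of_bool (ok \<pi> (inp i u x y)) + of_bool (ok \<pi> (inp i u (insert j x) y))))
        (\<Sum>i\<in>I. \<Sum>u\<in>Us. w u * frame_sum {..<m} (\<lambda>x y. \<Sum>j\<in>y. 1 + 1))"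
        by (intro lower_mean_sum lower_mean_mult lower_mean_frame_sum lower_mean_add mean inp_sub)
          (simp add: w_def prod_nonneg)
      then have le: "0.99 * (\<Sum>i\<in>I. \<Sum>u\<in>Us. w u * frame_sum {..<m} (\<lambda>x y. \<Sum>j\<in>y. 1 + 1))
        \<le> (real s - 1) * (\<Sum>u\<in>Us. w u) * (4 ^ m * (0.49 * real m))"
      proof (rule lower_mean_le[OF prob])
        fix \<pi> assume "\<pi> \<in> space R"
        then interpret union_protocol s k \<pi> B "ok \<pi>"
          by (rule protocol)
        show "(\<Sum>i\<in>I. \<Sum>u\<in>Us. w u * frame_sum {..<m} (\<lambda>x y. \<Sum>j\<in>y.
            of_bool (ok \<pi> (inp i u x y)) + of_bool (ok \<pi> (inp i u (insert j x) y))))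
          \<le> (real s - 1) * (\<Sum>u\<in>Us. w u) * (4 ^ m * (0.49 * real m))"
          unfolding inp_def w_def Us_def I_def m_def using 3
          by (intro many_sites_bound) (auto simp: B_def)
      qed
      \<comment> \<open>Full success counts \<open>2 * card y\<close>, with mean
        \<open>m / 2\<close>; the fraction 0.99 of it is \<open>0.495 * m\<close>, still above
        \<open>0.49 * m\<close>.\<close>
      have frames: "frame_sum {..<m} (\<lambda>x y. \<Sum>j\<in>y. 1 + 1) = 4 ^ m * (0.5 * real m)"
        using frame_sum_card[of "{..<m}"] frame_sum_mult[of "{..<m}" 2 "\<lambda>x y. real (card y)"]
        by (simp add: mult.commute)
      have total: "(\<Sum>i\<in>I. \<Sum>u\<in>Us. w u * F) = (real s - 1) * (\<Sum>u\<in>Us. w u) * F" for F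
        using 3 by (simp add: I_def sum_distrib_right[symmetric] of_nat_diff)
      define P where "P = (real s - 1) * (\<Sum>u\<in>Us. w u) * (4 ^ m * real m)"
      have "0.99 * ((real s - 1) * (\<Sum>u\<in>Us. w u) * (4 ^ m * (0.5 * real m))) = 0.495 * P"
        "(real s - 1) * (\<Sum>u\<in>Us. w u) * (4 ^ m * (0.49 * real m)) = 0.49 * P"
        by (simp_all add: P_def)
      then have "0.495 * P \<le> 0.49 * P"
        using le unfolding total frames by (simp only:)
      moreover have "0 < (\<Sum>u\<in>Us. w u)"
      proof (rule sum_pos)
        show "finite Us"
          by (simp add: Us_def I_def finite_PiE)
        show "Us \<noteq> {}"
          by (auto simp: Us_def PiE_eq_empty_iff)
        show "0 < w u" for u
          by (simp add: w_def prod_pos)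
      qed
      then have "0 < P"
        using 3 by (simp add: P_def m_def)
      ultimately show False
        by simp
    qed
  qed
  show ?thesis
  proof (intro exI[of _ "1 / 10000"] conjI exI[of _ 2] ballI allI impI)
    fix c weighted and obj :: "(nat \<Rightarrow> nat \<Rightarrow> real) \<Rightarrow> (nat \<Rightarrow> real) \<Rightarrow> nat set \<Rightarrow> real" and s k :: nat
    assume a: "c \<in> {1..1.01::real}" "obj \<in> {kmedian_cost, kmeans_cost}" "1 \<le> s" "1 \<le> k"
    \<comment> \<open>The square of \<open>s - k\<close> is nonnegative; this gives the exponent
      \<open>K = 2\<close>.\<close>
    have "4 * k * s \<le> (s + k)\<^sup>2"
      using sum_power2_ge_zero[of "int s - int k" 0]
      by (simp add: power2_eq_square algebra_simps flip: of_nat_le_iff[where ?'a = int])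
    then show "\<exists>S d. Metric_space S d \<and> finite S \<and> S \<noteq> {} \<and> card S \<le> (s + k) ^ 2 \<and>
       (\<forall>R. randomized_protocol s R \<longrightarrow>
            computes_bicriteria 0.99 weighted (obj d) S s k (7.1 - 6 * c) c R \<longrightarrow>
            communication weighted S s R \<ge> ereal (1 / 10000 * real s * real k))"
      using a bound[OF a]
      by (intro exI[of _ "{..<4 * k * s}"] exI[of _ "loc_dist s k"])
        (auto simp: Metric_space_loc_dist lessThan_empty_iff)
  qed simp
qed

end
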